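(* Let $K$ be a number field with ring of integers $\mathfrak{o}$. For any given nonzero $\Delta\in\mathfrak{o}$ (not necessarily a square modulo $4$), let $\mathfrak{s}$ be the largest integral ideal of $K$ whose square divides $\Delta$, and let $\mathfrak{t}$ be the largest integral ideal dividing $2$ such that $\Delta$ is a square modulo $(\mathfrak{s}\mathfrak{t})^2$. Then $$D_{K(\sqrt{\Delta})/K} = 4\Delta/(\mathfrak{s}\mathfrak{t})^2 .$$ In particular, if $\Delta$ is a discriminant in $K$, then $$D_{K(\sqrt{\Delta})/K} = \Delta/\mathfrak{f}_\Delta^2 .$$
   Context: Both displayed identities are identities of integral ideals of $K$; an element of $K^\times$ stands for the fractional ideal it generates. $D_{L/K}$ denotes the relative discriminant ideal of $L/K$ (the unit ideal if $L=K$). "Largest" ideal is meant with respect to divisibility (every ideal with the stated property divides it). "$\Delta$ is a square modulo an ideal $\mathfrak{m}$" means $\Delta\equiv x^2 \bmod \mathfrak{m}$ for some $x\in\mathfrak{o}$ ($x$ need not be prime to $\mathfrak m$). A discriminant in $K$ is a nonzero $\Delta\in\mathfrak{o}$ which is a square modulo $4\mathfrak{o}$. For a discriminant $\Delta$ in $K$, $\mathfrak{f}_\Delta$ is the largest integral ideal of $K$ whose square divides $\Delta$ and such that $\Delta\equiv x^2\bmod 4\mathfrak{f}_\Delta^2$ for some $x\in\mathfrak{o}$. *)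

theory Defs
  imports
    "HOL-Algebra.Algebraic_Closure_Type"
    "HOL-Algebra.Ideal_Product"
    "HOL-Algebra.Divisibility"
    "HOL-Algebra.Generated_Fields"
    "HOL-Algebra.Embedded_Algebras"
    "Jordan_Normal_Form.Determinant"
begin

text \<open>
  All fields are subfields of one ambient field of characteristic zero, given by an arbitrary
  type \<open>'a :: field_char_0\<close>. The library constant \<^const>\<open>ring_of_type_algebra\<close>
  is that ambient field as a record, so that ideals, subfields, spans and dimensions
  are those of HOL-Algebra.
\<close>

abbreviation ambient :: "'a :: field_char_0 ring"
  where "ambient \<equiv> ring_of_type_algebra"

definition number_field :: "'a :: field_char_0 set \<Rightarrow> bool"
  where "number_field K \<longleftrightarrow> subfield K ambient \<and> (\<exists>n. ring.dimension ambient n \<rat> K)"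

definition ring_of_integers :: "'a :: field_char_0 set \<Rightarrow> 'a ring"
  where "ring_of_integers K = ambient\<lparr>carrier := {x \<in> K. algebraic_int x}\<rparr>"

text \<open>
  The monoid of integral ideals: its multiplication is the product of ideals, so that
  \<open>divides\<close> is divisibility of ideals and \<open>[^]\<close> is the power of an ideal.
\<close>

abbreviation integral_ideals :: "'a :: field_char_0 set \<Rightarrow> 'a set ring"
  where "integral_ideals K \<equiv> ideals_set (ring_of_integers K)"

abbreviation principal_ideal :: "'a :: field_char_0 set \<Rightarrow> 'a \<Rightarrow> 'a set"
  where "principal_ideal K a \<equiv> PIdl\<^bsub>ring_of_integers K\<^esub> a"

definition largest_ideal :: "'a :: field_char_0 set \<Rightarrow> ('a set \<Rightarrow> bool) \<Rightarrow> 'a set"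
  where "largest_ideal K P =
    (THE I. I \<in> carrier (integral_ideals K) \<and> P I \<and>
       (\<forall>J \<in> carrier (integral_ideals K). P J \<longrightarrow> J divides\<^bsub>integral_ideals K\<^esub> I))"

text \<open>
  Quotients of fractional ideals, as the product of \<open>I\<close> with the inverse
  of \<open>J\<close>. The set \<^term>\<open>ideal_prod ambient I J\<close> of finite sums of products
  makes sense for arbitrary subsets of \<open>K\<close>, not only for integral ideals.
\<close>

definition inverse_ideal :: "'a :: field_char_0 set \<Rightarrow> 'a set \<Rightarrow> 'a set"
  where "inverse_ideal K J = {x \<in> K. \<forall>y \<in> J. x * y \<in> carrier (ring_of_integers K)}"

definition ideal_quotient :: "'a :: field_char_0 set \<Rightarrow> 'a set \<Rightarrow> 'a set \<Rightarrow> 'a set"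
  where "ideal_quotient K I J = ideal_prod ambient I (inverse_ideal K J)"

definition square_modulo :: "'a :: field_char_0 set \<Rightarrow> 'a \<Rightarrow> 'a set \<Rightarrow> bool"
  where "square_modulo K \<Delta> \<mm> \<longleftrightarrow> (\<exists>x \<in> carrier (ring_of_integers K). \<Delta> - x ^ 2 \<in> \<mm>)"

definition is_discriminant :: "'a :: field_char_0 set \<Rightarrow> 'a \<Rightarrow> bool"
  where "is_discriminant K \<Delta> \<longleftrightarrow>
    \<Delta> \<in> carrier (ring_of_integers K) \<and> \<Delta> \<noteq> 0 \<and> square_modulo K \<Delta> (principal_ideal K 4)"

definition conductor_ideal :: "'a :: field_char_0 set \<Rightarrow> 'a \<Rightarrow> 'a set"
  where "conductor_ideal K \<Delta> = largest_ideal K (\<lambda>f.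
    f [^]\<^bsub>integral_ideals K\<^esub> (2::nat) divides\<^bsub>integral_ideals K\<^esub> principal_ideal K \<Delta> \<and>
    square_modulo K \<Delta>
      (principal_ideal K 4 \<otimes>\<^bsub>integral_ideals K\<^esub> f [^]\<^bsub>integral_ideals K\<^esub> (2::nat)))"

definition field_basis :: "'a :: field_char_0 set \<Rightarrow> 'a set \<Rightarrow> 'a list \<Rightarrow> bool"
  where "field_basis K L b \<longleftrightarrow> ring.independent ambient K b \<and> ring.Span ambient K b = L"

text \<open>\<open>A\<close> is the matrix of multiplication by \<open>x\<close> with respect to the basis \<open>b\<close>.\<close>

definition mult_matrix :: "'a :: field_char_0 set \<Rightarrow> 'a list \<Rightarrow> 'a \<Rightarrow> 'a mat \<Rightarrow> bool"
  where "mult_matrix K b x A \<longleftrightarrow>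
    A \<in> carrier_mat (length b) (length b) \<and> elements_mat A \<subseteq> K \<and>
    (\<forall>j < length b. x * b ! j = (\<Sum>i < length b. A $$ (i, j) * b ! i))"

definition rel_trace :: "'a :: field_char_0 set \<Rightarrow> 'a set \<Rightarrow> 'a \<Rightarrow> 'a"
  where "rel_trace K L x =
    (THE t. \<exists>b A. field_basis K L b \<and> mult_matrix K b x A \<and> t = (\<Sum>i < length b. A $$ (i, i)))"

definition basis_discriminant :: "'a :: field_char_0 set \<Rightarrow> 'a set \<Rightarrow> 'a list \<Rightarrow> 'a"
  where "basis_discriminant K L b =
    det (mat (length b) (length b) (\<lambda>(i, j). rel_trace K L (b ! i * b ! j)))"

text \<open>
  The ideal generated by the discriminants of all \<open>K\<close>-bases of \<open>L\<close> consisting of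
  integers of \<open>L\<close>. (In general the integers of \<open>L\<close> are not free over those of \<open>K\<close>, so that
  a single basis does not suffice.)
\<close>

definition relative_discriminant :: "'a :: field_char_0 set \<Rightarrow> 'a set \<Rightarrow> 'a set"
  where "relative_discriminant K L =
    Idl\<^bsub>ring_of_integers K\<^esub>
      {basis_discriminant K L b | b. field_basis K L b \<and> set b \<subseteq> carrier (ring_of_integers L)}"

end

theory Submission
  imports Defs "Jordan_Normal_Form.Char_Poly"
begin

text \<open>
  Let \<open>\<O>\<close> be the ring of integers of \<open>K\<close> and \<open>\<delta>\<^sup>2 = \<Delta>\<close>. The fractional ideals
  \<open>\<CC> = {c. c\<delta> integral}\<close> and \<open>\<BB> = {b. a + b\<delta> and a - b\<delta> integral for some a \<in> K}\<close> determine
  all ideals in question. A square of an ideal is generated by squares of elements, so \<open>\<SS> = \<CC>\<^sup>-\<^sup>1\<close> is the largest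
  ideal with \<open>\<SS>\<^sup>2 | \<Delta>\<close>. With \<open>\<FF> = \<BB>\<^sup>-\<^sup>1\<close>, the ideal \<open>\<TT> = \<FF>\<SS>\<^sup>-\<^sup>1\<close> is the largest one of the second
  kind: that \<open>\<Delta>\<close> is a square modulo \<open>\<FF>\<^sup>2\<close> follows by splitting the projection of the
  integers \<open>a + b\<delta>\<close> onto the projective module \<open>\<BB>\<close>. For a discriminant \<open>\<Delta>\<close>, the conductor is \<open>\<FF> / 2\<close>.
  The basis \<open>a + b\<delta>, a' + b'\<delta>\<close> has discriminant \<open>4\<Delta>(ab' - a'b)\<^sup>2\<close> with \<open>ab' - a'b \<in> \<BB>\<close>, and
  \<open>1, a + b\<delta>\<close> has discriminant \<open>4\<Delta>b\<^sup>2\<close>, so the relative discriminant is \<open>4\<Delta>\<BB>\<^sup>2\<close>.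

  Ideals of \<open>\<O>\<close> are invertible by an argument of Dedekind and Kronecker: if \<open>f\<close> is a primitive integer
  polynomial with root \<open>z\<close>, the coefficients of \<open>f(T) / (T - z)\<close> generate the inverse of \<open>(1, z)\<close>.
  This passes to finitely many generators, and ideals are finitely generated
  because \<open>K\<close> has finite dimension over the rationals.
\<close>

section \<open>Algebraic integers\<close>

unbundle no fps_syntax

text \<open>Makes \<open>subspace\<close> mean additive subgroup and \<open>span\<close> the
  subgroup generated by a set, in any commutative ring.\<close>

interpretation int_module: Modules.module "\<lambda>(c::int) (x::'a::comm_ring_1). of_int c * x"
  by unfold_locales (auto simp: algebra_simps)

abbreviation int_span :: "'a::comm_ring_1 set \<Rightarrow> 'a set"
  where "int_span \<equiv> int_module.span"

lemma int_span_finiteE: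
  assumes "finite S" "x \<in> int_span S"
  obtains c where "x = (\<Sum>v\<in>S. of_int (c v) * v)"
  using assms int_module.span_finite[of S] by auto

text \<open>The determinant trick: multiplication by \<open>x\<close> acts on the generators through
  an integer matrix, with the vector of generators as eigenvector, so \<open>x\<close> is a root of
  a monic integer polynomial. The nonzero \<open>v\<close> makes the eigenvector nonzero.\<close>

lemma algebraic_int_if_stable_span:
  fixes x :: "'a::field_char_0"
  assumes S: "finite S" "v \<in> S" "v \<noteq> 0" and stable: "\<And>s. s \<in> S \<Longrightarrow> x * s \<in> int_span S"
  shows "algebraic_int x"
proof -
  obtain f where f: "bij_betw f {0..<card S} S"
    using S(1) ex_bij_betw_nat_finite by blast
  define n where "n = card S"
  have "\<exists>c. x * s = (\<Sum>v\<in>S. of_int (c v) * v)" if "s \<in> S" for s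
    using int_span_finiteE[OF S(1) stable[OF that]] by metis
  then obtain c where c: "\<And>s. s \<in> S \<Longrightarrow> x * s = (\<Sum>v\<in>S. of_int (c s v) * v)"
    by metis
  define B where "B = mat n n (\<lambda>(i,j). c (f i) (f j))"
  define A where "A = map_mat (of_int :: int \<Rightarrow> 'a) B"
  define w where "w = vec n f"
  have B: "B \<in> carrier_mat n n" and A: "A \<in> carrier_mat n n" and w: "w \<in> carrier_vec n"
    by (auto simp: B_def A_def w_def)
  have fS: "f i \<in> S" if "i < n" for i
    using that f by (auto simp: n_def bij_betw_def)
  have "A *\<^sub>v w = x \<cdot>\<^sub>v w"
  proof (rule eq_vecI)
    fix i assume i: "i < dim_vec (x \<cdot>\<^sub>v w)"
    hence i': "i < n" by (simp add: w_def)
    have "(A *\<^sub>v w) $ i = (\<Sum>j=0..<n. of_int (c (f i) (f j)) * f j)"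
      using i' by (simp add: A_def B_def w_def scalar_prod_def)
    also have "\<dots> = (\<Sum>v\<in>S. of_int (c (f i) v) * v)"
      unfolding n_def by (rule sum.reindex_bij_betw[OF f])
    also have "\<dots> = (x \<cdot>\<^sub>v w) $ i"
      using c[OF fS[OF i']] i' by (simp add: w_def)
    finally show "(A *\<^sub>v w) $ i = (x \<cdot>\<^sub>v w) $ i" .
  qed (simp add: A_def B_def w_def)
  moreover have "w \<noteq> 0\<^sub>v n"
  proof -
    have "v \<in> f ` {0..<card S}" using f S(2) by (auto simp: bij_betw_def)
    then obtain i where "i < n" "f i = v" by (auto simp: n_def)
    thus ?thesis using S(3) by (auto simp: w_def vec_eq_iff)
  qed
  ultimately have "eigenvector A w x"
    using A w by (auto simp: eigenvector_def)
  hence "poly (char_poly A) x = 0"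
    using eigenvalue_root_char_poly[OF A] by (auto simp: eigenvalue_def)
  moreover have "char_poly A = map_poly of_int (char_poly B)"
    unfolding A_def by (rule of_int_hom.char_poly_hom[OF B])
  moreover have "lead_coeff (char_poly B) = 1"
    using degree_monic_char_poly[OF B] by simp
  ultimately show ?thesis
    by (auto simp: algebraic_int_altdef_ipoly)
qed

section \<open>Rings that are finitely generated as abelian groups\<close>

lemma int_subspace_vimage_mult:
  fixes M :: "'a::comm_ring_1 set"
  assumes "int_module.subspace M"
  shows "int_module.subspace {x. r * x \<in> M}" "int_module.subspace {x. x * r \<in> M}"
proof -
  show *: "int_module.subspace {x. r * x \<in> M}"
    using assms by (simp add: int_module.subspace_def distrib_left mult.left_commute[of r])
  show "int_module.subspace {x. x * r \<in> M}"
    using * by (simp add: mult.commute)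
qed

text \<open>The generators may satisfy relations, as the determinant trick asks only for finitely
  many of them. Closure under addition comes from the span.\<close>

definition int_order :: "'a::comm_ring_1 set \<Rightarrow> bool"
  where "int_order R \<longleftrightarrow> 1 \<in> R \<and> (\<forall>x\<in>R. \<forall>y\<in>R. x * y \<in> R) \<and> (\<exists>S. finite S \<and> R = int_span S)"

lemma int_orderD:
  assumes "int_order R"
  shows "1 \<in> R" "0 \<in> R" "\<And>x y. x \<in> R \<Longrightarrow> y \<in> R \<Longrightarrow> x * y \<in> R"
    "\<And>x y. x \<in> R \<Longrightarrow> y \<in> R \<Longrightarrow> x + y \<in> R" "\<And>x. x \<in> R \<Longrightarrow> - x \<in> R"
  using assms int_module.span_zero int_module.span_add int_module.span_neg
  unfolding int_order_def by auto

text \<open>\<open>R\<close> is stable under multiplication by \<open>x\<close>, and some generator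
  is nonzero because \<open>R\<close> contains 1.\<close>

lemma int_order_algebraic_int:
  fixes x :: "'a::field_char_0"
  assumes R: "int_order R" and x: "x \<in> R"
  shows "algebraic_int x"
proof -
  obtain S where S: "finite S" "R = int_span S" using R by (auto simp: int_order_def)
  have "\<exists>v\<in>S. v \<noteq> 0"
  proof (rule ccontr)
    assume "\<not> ?thesis"
    hence "int_span S \<subseteq> {0}"
      using int_module.span_minimal[of S "{0}"] by (auto simp: int_module.subspace_def)
    with int_orderD(1)[OF R] S show False by auto
  qed
  then obtain v where "v \<in> S" "v \<noteq> 0" by auto
  thus ?thesis
  proof (rule algebraic_int_if_stable_span[OF S(1)])
    fix s assume "s \<in> S"
    hence "s \<in> R" using S int_module.span_base by auto
    thus "x * s \<in> int_span S" using int_orderD(3)[OF R x] S by auto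
  qed
qed

lemma int_order_span_one: "int_order (int_span {1::'a::comm_ring_1})"
proof -
  have *: "int_span {1::'a} = \<int>"
    using int_module.span_finite[of "{1::'a}"] by (auto simp: Ints_def)
  show ?thesis unfolding int_order_def
  proof (intro conjI exI[of _ "{1}"] ballI)
    show "1 \<in> int_span {1::'a}" by (intro int_module.span_base) auto
    fix x y :: 'a assume "x \<in> int_span {1}" "y \<in> int_span {1}"
    thus "x * y \<in> int_span {1}" unfolding * by (rule Ints_mult)
  qed auto
qed

text \<open>The products \<open>s * z ^ i\<close> with \<open>i < n\<close> span \<open>R'\<close>.
  The relation brings the exponent \<open>n\<close> back below \<open>n\<close>, so the span is
  stable under \<open>z\<close>.\<close>

lemma int_order_adjoin:
  fixes z :: "'a::comm_ring_1"
  assumes R: "int_order R" and a: "\<And>i. i < n \<Longrightarrow> a i \<in> R" and z: "z ^ n = (\<Sum>i<n. a i * z ^ i)"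
  obtains R' where "int_order R'" "R \<subseteq> R'" "z \<in> R'"
proof -
  note RD = int_orderD[OF R]
  obtain S where S: "finite S" "R = int_span S" using R by (auto simp: int_order_def)
  define S' where "S' = (\<lambda>(s,i). s * z ^ i) ` (S \<times> {..<n})"
  define R' where "R' = int_span S'"
  have add: "x + y \<in> R'" if "x \<in> R'" "y \<in> R'" for x y
    using that int_module.span_add by (auto simp: R'_def)
  have sub: "int_module.subspace R'" by (simp add: R'_def)
  have monom: "r * z ^ i \<in> R'" if "r \<in> R" "i < n" for r i
  proof -
    have "int_span S \<subseteq> {r. r * z ^ i \<in> R'}"
    proof (rule int_module.span_minimal)
      show "S \<subseteq> {r. r * z ^ i \<in> R'}"
        using that by (auto simp: R'_def S'_def intro!: int_module.span_base)
      show "int_module.subspace {r. r * z ^ i \<in> R'}" by (rule int_subspace_vimage_mult[OF sub])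
    qed
    thus ?thesis using that S by auto
  qed
  have monom_le: "r * z ^ i \<in> R'" if "r \<in> R" "i \<le> n" for r i
  proof (cases "i = n")
    case True
    have "r * z ^ i = (\<Sum>i<n. (r * a i) * z ^ i)"
      using True z by (simp add: sum_distrib_left mult.assoc)
    also have "\<dots> \<in> R'"
      unfolding R'_def using monom RD(3)[OF that(1) a] 
      by (intro int_module.span_sum) (auto simp: R'_def)
    finally show ?thesis .
  qed (use that monom in auto)
  have R'_induct: "x \<in> M" if "x \<in> R'" "int_module.subspace M" "\<And>r i. r \<in> R \<Longrightarrow> i < n \<Longrightarrow> r * z ^ i \<in> M" for x M
  proof -
    have "R' \<subseteq> M" unfolding R'_def
    proof (rule int_module.span_minimal)
      show "S' \<subseteq> M" using that(3) S int_module.span_base[of _ S] by (auto simp: S'_def)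
    qed fact
    thus ?thesis using that by auto
  qed
  have Rmul: "r * x \<in> R'" if "r \<in> R" "x \<in> R'" for r x
  proof -
    have "x \<in> {x. r * x \<in> R'}"
    proof (rule R'_induct[OF that(2)])
      show "int_module.subspace {x. r * x \<in> R'}" by (rule int_subspace_vimage_mult[OF sub])
      show "r' * z ^ i \<in> {x. r * x \<in> R'}" if "r' \<in> R" "i < n" for r' i
        using monom[OF RD(3)[OF \<open>r \<in> R\<close> that(1)] that(2)] by (simp add: mult.assoc)
    qed
    thus ?thesis by simp
  qed
  have zmul: "z * x \<in> R'" if "x \<in> R'" for x
  proof -
    have "x \<in> {x. z * x \<in> R'}"
    proof (rule R'_induct[OF that])
      show "int_module.subspace {x. z * x \<in> R'}" by (rule int_subspace_vimage_mult[OF sub])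
      show "r' * z ^ i \<in> {x. z * x \<in> R'}" if "r' \<in> R" "i < n" for r' i
        using monom_le[OF that(1), of "Suc i"] that by (simp add: mult.left_commute)
    qed
    thus ?thesis by simp
  qed
  have zpow: "z ^ i * x \<in> R'" if "x \<in> R'" for x i
    using that by (induction i) (auto simp: mult.assoc intro: zmul)
  have mul: "x * y \<in> R'" if "x \<in> R'" "y \<in> R'" for x y
  proof -
    have "x \<in> {x. x * y \<in> R'}"
    proof (rule R'_induct[OF that(1)])
      show "int_module.subspace {x. x * y \<in> R'}" by (rule int_subspace_vimage_mult[OF sub])
      show "r' * z ^ i \<in> {x. x * y \<in> R'}" if "r' \<in> R" "i < n" for r' i
        using Rmul[OF that(1) zpow[OF \<open>y \<in> R'\<close>]] by (simp add: mult.assoc)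
    qed
    thus ?thesis by simp
  qed
  have one: "1 \<in> R'" using monom_le[OF RD(1), of 0] by simp
  have "int_order R'"
    unfolding int_order_def using one mul S(1)
    by (auto simp: R'_def S'_def intro!: exI[of _ S'])
  moreover have "R \<subseteq> R'" using monom_le[of _ 0] by auto
  moreover have "z \<in> R'" using zmul[OF one] by simp
  ultimately show ?thesis using that by blast
qed

lemma algebraic_int_monicE:
  fixes x :: "'a::field_char_0"
  assumes "algebraic_int x"
  obtains n and c :: "nat \<Rightarrow> int" where "x ^ n = (\<Sum>i<n. of_int (c i) * x ^ i)"
proof -
  obtain p :: "int poly" where p: "poly (map_poly of_int p) x = 0" "lead_coeff p = 1"
    using assms by (auto simp: algebraic_int_altdef_ipoly)
  define n where "n = degree p"
  have "0 = (\<Sum>i\<le>n. of_int (coeff p i) * x ^ i)"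
    using p(1) by (simp add: poly_altdef coeff_map_poly degree_map_poly n_def)
  also have "\<dots> = (\<Sum>i<n. of_int (coeff p i) * x ^ i) + x ^ n"
    using p(2) by (simp add: lessThan_Suc_atMost[symmetric] n_def)
  finally have "x ^ n = - (\<Sum>i<n. of_int (coeff p i) * x ^ i)"
    by (simp add: eq_neg_iff_add_eq_0 add.commute)
  hence "x ^ n = (\<Sum>i<n. of_int (- coeff p i) * x ^ i)" by (simp add: sum_negf)
  thus ?thesis by (rule that)
qed

lemma int_order_adjoin_algebraic_int:
  fixes x :: "'a::field_char_0"
  assumes R: "int_order R" and x: "algebraic_int x"
  obtains R' where "int_order R'" "R \<subseteq> R'" "x \<in> R'"
proof -
  obtain n and c :: "nat \<Rightarrow> int" where c: "x ^ n = (\<Sum>i<n. of_int (c i) * x ^ i)"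
    using algebraic_int_monicE[OF x] .
  have "of_int k \<in> R" for k
  proof -
    obtain S where S: "R = int_span S" using R by (auto simp: int_order_def)
    show ?thesis using int_module.span_scale[of 1 S k] int_orderD(1)[OF R] S by simp
  qed
  thus ?thesis using int_order_adjoin[OF R _ c] that by blast
qed

text \<open>Adjoins the elements one at a time, so that sums and products of algebraic integers can
  be formed inside one finitely generated ring.\<close>

lemma int_order_containing:
  fixes A :: "'a::field_char_0 set"
  assumes "finite A" "\<And>x. x \<in> A \<Longrightarrow> algebraic_int x"
  obtains R where "int_order R" "A \<subseteq> R"
proof -
  have "\<exists>R. int_order R \<and> A \<subseteq> R"
    using assms
  proof (induction A)
    case (insert x A)
    then obtain R where R: "int_order R" "A \<subseteq> R" by auto
    obtain R' where "int_order R'" "R \<subseteq> R'" "x \<in> R'"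
      using int_order_adjoin_algebraic_int[OF R(1), of x] insert.prems by auto
    thus ?case using R by auto
  qed (use int_order_span_one in auto)
  thus ?thesis using that by auto
qed

lemma algebraic_int_add [intro]:
  fixes x y :: "'a::field_char_0"
  assumes "algebraic_int x" "algebraic_int y"
  shows "algebraic_int (x + y)"
proof -
  obtain R where R: "int_order R" "{x, y} \<subseteq> R"
    using int_order_containing[of "{x, y}"] assms by auto
  thus ?thesis using int_orderD(4)[OF R(1)] int_order_algebraic_int[OF R(1)] by auto
qed

lemma algebraic_int_mult [intro]:
  fixes x y :: "'a::field_char_0"
  assumes "algebraic_int x" "algebraic_int y"
  shows "algebraic_int (x * y)"
proof -
  obtain R where R: "int_order R" "{x, y} \<subseteq> R"
    using int_order_containing[of "{x, y}"] assms by auto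
  thus ?thesis using int_orderD(3)[OF R(1)] int_order_algebraic_int[OF R(1)] by auto
qed

lemma algebraic_int_diff [intro]:
  fixes x y :: "'a::field_char_0"
  assumes "algebraic_int x" "algebraic_int y"
  shows "algebraic_int (x - y)"
  using algebraic_int_add[of x "- y"] assms by auto

lemma algebraic_int_of_int [simp, intro]: "algebraic_int (of_int k :: 'a::field_char_0)"
  by (auto intro: int_imp_algebraic_int)

lemma algebraic_int_power [intro]:
  fixes x :: "'a::field_char_0"
  assumes "algebraic_int x"
  shows "algebraic_int (x ^ n)"
  using assms algebraic_int_of_int[of 1, where 'a='a] by (induction n) auto

text \<open>Transitivity of integrality: the coefficients lie in one order, and adjoining
  \<open>z\<close> gives an order again.\<close>

lemma algebraic_int_if_integral:
  fixes z :: "'a::field_char_0"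
  assumes a: "\<And>i. i < n \<Longrightarrow> algebraic_int (a i)" and z: "z ^ n = (\<Sum>i<n. a i * z ^ i)"
  shows "algebraic_int z"
proof -
  obtain R where R: "int_order R" "a ` {..<n} \<subseteq> R"
    using int_order_containing[of "a ` {..<n}"] a by auto
  obtain R' where "int_order R'" "z \<in> R'"
    using int_order_adjoin[OF R(1) _ z] R(2) by (metis imageI lessThan_iff subsetD)
  thus ?thesis by (rule int_order_algebraic_int)
qed

lemma algebraic_int_square_iff [simp]:
  fixes z :: "'a::field_char_0"
  shows "algebraic_int (z ^ 2) \<longleftrightarrow> algebraic_int z"
proof
  assume *: "algebraic_int (z ^ 2)"
  show "algebraic_int z"
    by (rule algebraic_int_if_integral[of 2 "\<lambda>i. if i = 0 then z ^ 2 else 0"])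
       (use * in \<open>auto simp: numeral_2_eq_2\<close>)
qed auto

lemma algebraic_int_quadratic:
  fixes z :: "'a::field_char_0"
  assumes "algebraic_int p" "algebraic_int q" "z ^ 2 = p * z + q"
  shows "algebraic_int z"
  by (rule algebraic_int_if_integral[of 2 "\<lambda>i. if i = 0 then q else p"])
     (use assms in \<open>auto simp: numeral_2_eq_2 add.commute\<close>)

text \<open>Multiplying \<open>\<Sum> c\<^sub>i z\<^sup>i = 0\<close> by the power of \<open>c\<^sub>n\<close> of exponent \<open>n - 1\<close>
  gives a monic equation for \<open>c\<^sub>n z\<close>.\<close>

lemma algebraic_int_lead_coeff_mult:
  fixes z :: "'a::field_char_0"
  assumes c: "\<And>i. i \<le> n \<Longrightarrow> algebraic_int (c i)" and z: "(\<Sum>i\<le>n. c i * z ^ i) = 0"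
  shows "algebraic_int (c n * z)"
proof (cases "n = 0 \<or> c n = 0")
  case True
  thus ?thesis using z by auto
next
  case False
  define y where "y = c n * z"
  define a where "a = (\<lambda>i. - (c i * c n ^ (n - 1 - i)))"
  have "c n ^ (n - 1) * (\<Sum>i\<le>n. c i * z ^ i) = c n ^ (n - 1) * (\<Sum>i<n. c i * z ^ i) + y ^ n"
    using False by (cases n) (auto simp: lessThan_Suc_atMost[symmetric] y_def algebra_simps)
  moreover have "c n ^ (n - 1) * (\<Sum>i<n. c i * z ^ i) = (\<Sum>i<n. - a i * y ^ i)"
    unfolding sum_distrib_left
  proof (rule sum.cong)
    fix i assume i: "i \<in> {..<n}"
    hence "c n ^ (n - 1) = c n ^ (n - 1 - i) * c n ^ i"
      by (simp add: power_add[symmetric])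
    thus "c n ^ (n - 1) * (c i * z ^ i) = - a i * y ^ i"
      by (simp add: a_def y_def power_mult_distrib mult_ac)
  qed simp
  ultimately have "(\<Sum>i<n. - a i * y ^ i) + y ^ n = 0"
    by (simp add: z)
  hence "y ^ n = (\<Sum>i<n. a i * y ^ i)"
    by (simp add: sum_negf algebra_simps)
  moreover have "algebraic_int (a i)" if "i < n" for i
    using c[of i] c[of n] that by (auto simp: a_def)
  ultimately show ?thesis
    unfolding y_def[symmetric] by (blast intro: algebraic_int_if_integral[of n a])
qed

section \<open>Partitions of unity for fractional ideals\<close>

lemma ambient_simps [simp]:
  "carrier ambient = UNIV" "\<zero>\<^bsub>ambient\<^esub> = 0" "\<one>\<^bsub>ambient\<^esub> = 1"
  "x \<oplus>\<^bsub>ambient\<^esub> y = x + y" "x \<otimes>\<^bsub>ambient\<^esub> y = x * y"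
  by (simp_all add: ring_of_type_algebra_def)

lemma field_ambient: "Ring.field (ambient :: 'a::field_char_0 ring)"
  by (rule field_from_type_algebra)

interpretation ambient: cring "ambient :: 'a::field_char_0 ring"
  by (rule cring_from_type_algebra)

lemma ambient_a_inv [simp]: "\<ominus>\<^bsub>ambient\<^esub> x = - x"
  by (rule ambient.minus_equality) auto

lemma ambient_m_inv [simp]: "x \<noteq> 0 \<Longrightarrow> inv\<^bsub>ambient\<^esub> x = inverse x"
  by (rule ambient.comm_inv_char) auto

lemma subfield_ambientI:
  assumes "1 \<in> K" "\<And>x. x \<in> K \<Longrightarrow> - x \<in> K" "\<And>x y. x \<in> K \<Longrightarrow> y \<in> K \<Longrightarrow> x + y \<in> K"
    "\<And>x y. x \<in> K \<Longrightarrow> y \<in> K \<Longrightarrow> x * y \<in> K" "\<And>x. x \<in> K \<Longrightarrow> inverse x \<in> K"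
  shows "subfield K ambient"
  by (intro field.subfieldI'[OF field_ambient] ambient.subringI) (use assms in auto)

lemma subfield_Rats: "subfield \<rat> ambient"
  by (rule subfield_ambientI) auto

text \<open>\<open>combine\<close> stops at the end of the shorter list, hence the default
  coefficient 0.\<close>

lemma ambient_combine_eq_sum:
  "ambient.combine Ks Us = (\<Sum>i<length Us. (if i < length Ks then Ks ! i else 0) * Us ! i)"
proof (induction Ks Us rule: ambient.combine.induct)
  case (1 k Ks u Us)
  show ?case
    unfolding ambient.combine.simps 1 by (auto simp: sum.lessThan_Suc_shift simp del: sum.lessThan_Suc intro!: sum.cong)
qed auto

lemma common_denominator:
  fixes q :: "nat \<Rightarrow> 'a::field_char_0"
  assumes "\<And>i. i < n \<Longrightarrow> q i \<in> \<rat>"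
  obtains N :: int where "N \<noteq> 0" "\<And>i. i < n \<Longrightarrow> of_int N * q i \<in> \<int>"
proof -
  have "\<exists>N::int. N \<noteq> 0 \<and> (\<forall>i<n. of_int N * q i \<in> \<int>)"
    using assms
  proof (induction n)
    case (Suc n)
    then obtain N :: int where N: "N \<noteq> 0" "\<And>i. i < n \<Longrightarrow> of_int N * q i \<in> \<int>"
      by (metis less_Suc_eq)
    obtain a b where ab: "b > 0" "q n = of_int a / of_int b"
      using Suc.prems[of n] by (auto elim: Rats_cases')
    have "of_int (N * b) * q i \<in> \<int>" if "i < Suc n" for i
    proof (cases "i = n")
      case True
      have "of_int (N * b) * q i = of_int (N * a)" using ab True by simp
      thus ?thesis by (metis Ints_of_int)
    next
      case False
      have "of_int (N * b) * q i = of_int b * (of_int N * q i)" by simp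
      thus ?thesis using N(2)[of i] that False by (metis Ints_mult Ints_of_int less_Suc_eq)
    qed
    thus ?case using N ab by (intro exI[of _ "N * b"]) auto
  qed (auto intro: exI[of _ 1])
  thus ?thesis using that by blast
qed

text \<open>\<open>U\<close> is an ideal of the integers, and Bezout coefficients keep each
  successive gcd in it.\<close>

lemma subgroup_int_Gcd:
  fixes U :: "int set"
  assumes U: "0 \<in> U" "\<And>a b. a \<in> U \<Longrightarrow> b \<in> U \<Longrightarrow> a + b \<in> U" "\<And>k a. a \<in> U \<Longrightarrow> k * a \<in> U"
    and S: "finite S" "S \<subseteq> U"
  shows "Gcd S \<in> U"
  using S
proof (induction S)
  case (insert a S)
  obtain u v where "u * a + v * Gcd S = gcd a (Gcd S)" using bezout_int by blast
  thus ?case using insert U by (metis Gcd_insert insert_subset)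
qed (simp add: U)

section \<open>Number fields and integer relations between their elements\<close>

locale number_field_carrier =
  fixes K :: "'a::field_char_0 set"
  assumes number_field: "number_field K"
begin

lemma subfield_K: "subfield K ambient"
  using number_field by (simp add: number_field_def)

lemma K_closed [simp, intro]:
  "0 \<in> K" "1 \<in> K" "x \<in> K \<Longrightarrow> - x \<in> K" "x \<in> K \<Longrightarrow> y \<in> K \<Longrightarrow> x + y \<in> K"
  "x \<in> K \<Longrightarrow> y \<in> K \<Longrightarrow> x * y \<in> K"
  using subringE[OF subfieldE(1)[OF subfield_K]] by auto

lemma K_diff [simp, intro]: "x \<in> K \<Longrightarrow> y \<in> K \<Longrightarrow> x - y \<in> K"
  using K_closed(4)[of x "- y"] by auto

lemma K_inverse [simp, intro]: "x \<in> K \<Longrightarrow> inverse x \<in> K"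
  using ambient.subfield_m_inv(1)[OF subfield_K, of x] by (cases "x = 0") auto

lemma K_divide [simp, intro]: "x \<in> K \<Longrightarrow> y \<in> K \<Longrightarrow> x / y \<in> K"
  by (simp add: divide_inverse)

lemma K_power [simp, intro]: "x \<in> K \<Longrightarrow> x ^ n \<in> K"
  by (induction n) auto

lemma K_of_int [simp, intro]: "of_int k \<in> K"
proof -
  have "of_nat n \<in> K" for n by (induction n) auto
  thus ?thesis by (cases k) auto
qed

lemma K_numeral [simp, intro]: "numeral k \<in> K"
  using K_of_int[of "numeral k"] by simp

text \<open>\<open>d\<close> is the degree of \<open>K\<close> over the rationals:
  \<open>d + 1\<close> elements are dependent, and denominators can be cleared. It is chosen before
  \<open>f\<close>, so that one bound serves all families.\<close>

lemma int_relation: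
  obtains d where "\<And>f. (\<And>i. i \<le> d \<Longrightarrow> f i \<in> K) \<Longrightarrow>
    \<exists>c::nat \<Rightarrow> int. (\<exists>i\<le>d. c i \<noteq> 0) \<and> (\<Sum>i\<le>d. of_int (c i) * f i) = 0"
proof -
  obtain d where d: "ambient.dimension d \<rat> K"
    using number_field by (auto simp: number_field_def)
  show ?thesis
  proof (rule that)
    fix f :: "nat \<Rightarrow> 'a"
    assume f: "\<And>i. i \<le> d \<Longrightarrow> f i \<in> K"
    define Us where "Us = map f [0..<Suc d]"
    have len: "length Us = Suc d" by (simp add: Us_def)
    have Us: "set Us \<subseteq> K" using f by (auto simp: Us_def)
    have "\<not> ambient.independent \<rat> Us"
      using ambient.independent_length_le_dimension[OF subfield_Rats d _ Us] len by auto
    then obtain Ks where Ks: "set Ks \<subseteq> \<rat>" "ambient.combine Ks Us = 0"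
      "\<not> set (take (length Us) Ks) \<subseteq> {0}"
      using ambient.trivial_combine_imp_independent[OF subfield_Rats, of Us] by auto
    define k where "k = (\<lambda>i. if i < length Ks then Ks ! i else 0)"
    have "k i \<in> \<rat>" for i using Ks(1) by (auto simp: k_def)
    then obtain N :: int where N: "N \<noteq> 0" "\<And>i. i < Suc d \<Longrightarrow> of_int N * k i \<in> \<int>"
      using common_denominator[of "Suc d" k] by auto
    have "\<exists>e. of_int N * k i = of_int e" if "i < Suc d" for i
      using N(2)[OF that] by (auto elim: Ints_cases)
    then obtain c where c: "\<And>i. i < Suc d \<Longrightarrow> of_int N * k i = of_int (c i)"
      by metis
    have "(\<Sum>i\<le>d. of_int (c i) * f i) = (\<Sum>i<Suc d. of_int N * k i * f i)"
      using c by (intro sum.cong) auto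
    also have "\<dots> = of_int N * ambient.combine Ks Us"
      unfolding ambient_combine_eq_sum len sum_distrib_left
      by (intro sum.cong) (auto simp: k_def Us_def simp del: upt_Suc)
    finally have "(\<Sum>i\<le>d. of_int (c i) * f i) = 0" using Ks by simp
    moreover have "\<exists>i\<le>d. c i \<noteq> 0"
    proof -
      obtain x where "x \<in> set (take (Suc d) Ks)" "x \<noteq> 0" using Ks(3) len by auto
      then obtain i where "i < Suc d" "k i \<noteq> 0"
        by (auto simp: in_set_conv_nth k_def)
      thus ?thesis using c[of i] N(1) by (intro exI[of _ i]) auto
    qed
    ultimately show "\<exists>c::nat \<Rightarrow> int. (\<exists>i\<le>d. c i \<noteq> 0) \<and> (\<Sum>i\<le>d. of_int (c i) * f i) = 0"
      by blast
  qed
qed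

text \<open>Divides a relation by the gcd of its coefficients. Primitivity serves twice: 1 is an
  integer combination of the coefficients, and no prime divides them all.\<close>

lemma primitive_int_relation:
  obtains d where "\<And>f. (\<And>i. i \<le> d \<Longrightarrow> f i \<in> K) \<Longrightarrow>
    \<exists>c::nat \<Rightarrow> int. Gcd (c ` {..d}) = 1 \<and> (\<Sum>i\<le>d. of_int (c i) * f i) = 0"
proof -
  obtain d where d: "\<And>f. (\<And>i. i \<le> d \<Longrightarrow> f i \<in> K) \<Longrightarrow>
    \<exists>c::nat \<Rightarrow> int. (\<exists>i\<le>d. c i \<noteq> 0) \<and> (\<Sum>i\<le>d. of_int (c i) * f i) = 0"
    using int_relation by blast
  show ?thesis
  proof (rule that)
    fix f :: "nat \<Rightarrow> 'a"
    assume "\<And>i. i \<le> d \<Longrightarrow> f i \<in> K"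
    then obtain c :: "nat \<Rightarrow> int" where c: "\<exists>i\<le>d. c i \<noteq> 0" "(\<Sum>i\<le>d. of_int (c i) * f i) = 0"
      using d by blast
    define g where "g = Gcd (c ` {..d})"
    have g: "g \<noteq> 0" using c(1) by (auto simp: g_def Gcd_0_iff)
    have "\<exists>e. c i = g * e" if "i \<le> d" for i
    proof -
      have "g dvd c i" using that by (auto simp: g_def)
      thus ?thesis by (auto simp: dvd_def)
    qed
    then obtain c' where c': "\<And>i. i \<le> d \<Longrightarrow> c i = g * c' i"
      by metis
    have "of_int g * (\<Sum>i\<le>d. of_int (c' i) * f i) = (\<Sum>i\<le>d. of_int (c i) * f i)"
      unfolding sum_distrib_left using c' by (intro sum.cong) auto
    hence "(\<Sum>i\<le>d. of_int (c' i) * f i) = 0" using g c(2) by simp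
    moreover have "g * Gcd (c' ` {..d}) dvd Gcd (c ` {..d})"
      by (rule Gcd_greatest) (auto simp: c' intro!: mult_dvd_mono)
    hence "is_unit (Gcd (c' ` {..d}))" using g unfolding g_def[symmetric] by auto
    hence "Gcd (c' ` {..d}) = 1" using normalize_Gcd is_unit_normalize by metis
    ultimately show "\<exists>c::nat \<Rightarrow> int. Gcd (c ` {..d}) = 1 \<and> (\<Sum>i\<le>d. of_int (c i) * f i) = 0"
      by blast
  qed
qed

section \<open>The ring of integers and inverses of finitely generated ideals\<close>

definition \<O> :: "'a set"
  where "\<O> = {x \<in> K. algebraic_int x}"

lemma O_closed [simp, intro]:
  "0 \<in> \<O>" "1 \<in> \<O>" "x \<in> \<O> \<Longrightarrow> - x \<in> \<O>" "x \<in> \<O> \<Longrightarrow> y \<in> \<O> \<Longrightarrow> x + y \<in> \<O>"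
  "x \<in> \<O> \<Longrightarrow> y \<in> \<O> \<Longrightarrow> x - y \<in> \<O>" "x \<in> \<O> \<Longrightarrow> y \<in> \<O> \<Longrightarrow> x * y \<in> \<O>"
  "of_int k \<in> \<O>"
  using algebraic_int_of_int[of 1, where 'a='a] by (auto simp: \<O>_def)

lemma O_numeral [simp, intro]: "numeral k \<in> \<O>"
  using O_closed(7)[of "numeral k"] by simp

lemma O_power [simp, intro]: "x \<in> \<O> \<Longrightarrow> x ^ n \<in> \<O>"
  by (induction n) auto

lemma O_sum [intro]: "(\<And>i. i \<in> A \<Longrightarrow> f i \<in> \<O>) \<Longrightarrow> sum f A \<in> \<O>"
  by (induction A rule: infinite_finite_induct) auto

lemma O_imp_K [intro]: "x \<in> \<O> \<Longrightarrow> x \<in> K"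
  by (simp add: \<O>_def)

lemma O_square_iff: "x \<in> K \<Longrightarrow> x ^ 2 \<in> \<O> \<longleftrightarrow> x \<in> \<O>"
  by (simp add: \<O>_def)

text \<open>\<open>P\<close> and \<open>Q\<close> range over the inverse of the fractional ideal
  \<open>(1, z)\<close>, so \<open>c\<close> lies in the product of \<open>(1, z)\<close> with its
  inverse. For \<open>c = 1\<close> this is invertibility.\<close>

definition decomposable :: "'a \<Rightarrow> 'a \<Rightarrow> bool"
  where "decomposable z c \<longleftrightarrow>
    (\<exists>P Q. P \<in> \<O> \<and> z * P \<in> \<O> \<and> Q \<in> \<O> \<and> z * Q \<in> \<O> \<and> c = P - z * Q)"

lemma decomposableI:
  "P \<in> \<O> \<Longrightarrow> z * P \<in> \<O> \<Longrightarrow> Q \<in> \<O> \<Longrightarrow> z * Q \<in> \<O> \<Longrightarrow> c = P - z * Q \<Longrightarrow> decomposable z c"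
  by (auto simp: decomposable_def)

lemma decomposable_0: "decomposable z 0"
  by (rule decomposableI[of 0 _ 0]) auto

lemma decomposable_add:
  assumes "decomposable z c" "decomposable z d"
  shows "decomposable z (c + d)"
proof -
  obtain P Q P' Q' where
    "P \<in> \<O>" "z * P \<in> \<O>" "Q \<in> \<O>" "z * Q \<in> \<O>" "c = P - z * Q"
    "P' \<in> \<O>" "z * P' \<in> \<O>" "Q' \<in> \<O>" "z * Q' \<in> \<O>" "d = P' - z * Q'"
    using assms unfolding decomposable_def by blast
  thus ?thesis
    by (intro decomposableI[of "P + P'" _ "Q + Q'"]) (simp_all add: distrib_left)
qed

lemma decomposable_mult:
  assumes "decomposable z c" "r \<in> \<O>"
  shows "decomposable z (r * c)"
proof -
  obtain P Q where PQ: "P \<in> \<O>" "z * P \<in> \<O>" "Q \<in> \<O>" "z * Q \<in> \<O>" "c = P - z * Q"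
    using assms(1) unfolding decomposable_def by blast
  have "z * (r * P) = r * (z * P)" "z * (r * Q) = r * (z * Q)" by simp_all
  with PQ assms(2) show ?thesis
    by (intro decomposableI[of "r * P" _ "r * Q"]) (simp_all only: right_diff_distrib O_closed)
qed

text \<open>The coefficients of \<open>f(T) / (T - z)\<close> are integral, and so are their products with \<open>z\<close>,
  if \<open>f\<close> is an integral polynomial with root \<open>z\<close>; each coefficient of \<open>f\<close> is of the
  form \<open>P - z * Q\<close> for two of them.\<close>

lemma coefficient_decomposable:
  assumes "\<And>i. i \<le> n \<Longrightarrow> c i \<in> \<O>" "z \<in> K" "(\<Sum>i\<le>n. c i * z ^ i) = 0" "i \<le> n"
  shows "decomposable z (c i)"
  using assms
proof (induction n arbitrary: c i)
  case 0
  thus ?case using decomposable_0 by simp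
next
  case (Suc n)
  define e where "e = c (Suc n)"
  have e: "e \<in> \<O>" using Suc.prems(1) by (simp add: e_def)
  have "algebraic_int (e * z)"
    unfolding e_def using Suc.prems(1) 
    by (intro algebraic_int_lead_coeff_mult[OF _ Suc.prems(3)]) (simp add: \<O>_def)
  hence ze: "z * e \<in> \<O>"
    using e Suc.prems(2) by (simp add: \<O>_def mult.commute)
  show ?case
  proof (cases "i = Suc n")
    case True
    thus ?thesis using e ze by (intro decomposableI[of e _ 0]) (auto simp: e_def)
  next
    case False
    \<comment> \<open>A Horner step: at the root \<open>z\<close> the leading term is absorbed into
      the coefficient of \<open>z ^ n\<close>, which lowers the degree by one.\<close>
    define c' where "c' = c(n := c n + z * e)"
    have "(\<Sum>i\<le>n. c' i * z ^ i) = (\<Sum>i<n. c i * z ^ i) + (c n + z * e) * z ^ n"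
      by (simp add: c'_def lessThan_Suc_atMost[symmetric])
    also have "\<dots> = (\<Sum>i\<le>Suc n. c i * z ^ i)"
      by (simp add: lessThan_Suc_atMost[symmetric] e_def algebra_simps)
    finally have sum0: "(\<Sum>i\<le>n. c' i * z ^ i) = 0" using Suc.prems(3) by simp
    have "c' j \<in> \<O>" if "j \<le> n" for j using that Suc.prems(1) ze by (auto simp: c'_def)
    from Suc.IH[OF this Suc.prems(2) sum0, of i]
    have c': "decomposable z (c' i)" using Suc.prems(4) False by auto
    show ?thesis
    proof (cases "i = n")
      case True
      \<comment> \<open>Undoes the change made to the coefficient of index \<open>n\<close>.\<close>
      have "decomposable z (- (z * e))"
        using e ze by (intro decomposableI[of 0 _ e]) auto
      from decomposable_add[OF c' this] show ?thesis using True by (simp add: c'_def)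
    qed (use c' in \<open>auto simp: c'_def\<close>)
  qed
qed

text \<open>The coefficients of a primitive relation between the powers of \<open>z\<close> are
  decomposable, and so is their gcd 1.\<close>

lemma decomposable_1:
  assumes z: "z \<in> K"
  shows "decomposable z 1"
proof -
  define U where "U = {k::int. decomposable z (of_int k)}"
  obtain d :: nat where d: "\<And>f. (\<And>i. i \<le> d \<Longrightarrow> f i \<in> K) \<Longrightarrow>
    \<exists>c::nat \<Rightarrow> int. Gcd (c ` {..d}) = 1 \<and> (\<Sum>i\<le>d. of_int (c i) * f i) = 0"
    using primitive_int_relation by blast
  obtain c :: "nat \<Rightarrow> int" where c: "Gcd (c ` {..d}) = 1" "(\<Sum>i\<le>d. of_int (c i) * z ^ i) = 0"
    using d[of "\<lambda>i. z ^ i"] z by auto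
  have "c i \<in> U" if "i \<le> d" for i
    using coefficient_decomposable[OF _ z c(2) that] by (simp add: U_def)
  hence "Gcd (c ` {..d}) \<in> U"
    by (intro subgroup_int_Gcd)
       (auto simp: U_def decomposable_0 decomposable_add decomposable_mult)
  thus ?thesis using c(1) by (simp add: U_def)
qed

text \<open>Scales \<open>decomposable_1\<close> for \<open>z = y / x\<close>: the weights
  \<open>e\<close> and \<open>1 - e\<close> form a partition of unity for the ideal
  \<open>(x, y)\<close>. The equations avoid division by \<open>y\<close>, which may be 0.\<close>

lemma two_generators:
  assumes "x \<in> K" "y \<in> K" "x \<noteq> 0"
  obtains e r r' where "e \<in> \<O>" "r \<in> \<O>" "r' \<in> \<O>" "e * y = r * x" "(1 - e) * x = r' * y"
proof -
  obtain P Q where PQ: "P \<in> \<O>" "y / x * P \<in> \<O>" "Q \<in> \<O>" "1 = P - y / x * Q"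
    using decomposable_1[OF K_divide[OF assms(2,1)]] unfolding decomposable_def by blast
  show ?thesis
  proof (rule that[of P "y / x * P" "- Q"])
    show "P * y = y / x * P * x" using assms by simp
    have "1 - P = - (y / x * Q)" by (subst PQ(4)) simp
    thus "(1 - P) * x = - Q * y" using assms by simp
  qed (use PQ in auto)
qed

text \<open>The condition on \<open>g\<close> says that \<open>g x / x\<close> lies in the inverse
  of the ideal generated by \<open>F\<close>. A new generator \<open>z\<close> is compared with each
  old one by means of \<open>two_generators\<close>.\<close>

lemma finitely_many_generators:
  assumes "finite F" "F \<noteq> {}" "F \<subseteq> K - {0}"
  shows "\<exists>g. (\<forall>x\<in>F. g x \<in> \<O>) \<and> sum g F = 1 \<and> (\<forall>x\<in>F. \<forall>y\<in>F. \<exists>r\<in>\<O>. g x * y = r * x)"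
  using assms
proof (induction F rule: finite_ne_induct)
  case (singleton x)
  show ?case by (rule exI[of _ "\<lambda>_. 1"]) auto
next
  case (insert z F)
  then obtain g where g: "\<And>x. x \<in> F \<Longrightarrow> g x \<in> \<O>" "sum g F = 1"
    "\<And>x y. x \<in> F \<Longrightarrow> y \<in> F \<Longrightarrow> \<exists>r\<in>\<O>. g x * y = r * x" by blast
  have "\<exists>e\<in>\<O>. (\<exists>r\<in>\<O>. e * z = r * x) \<and> (\<exists>r'\<in>\<O>. (1 - e) * x = r' * z)" if "x \<in> F" for x
  proof -
    have "x \<in> K" "z \<in> K" "x \<noteq> 0" using insert.prems that by auto
    thus ?thesis by (metis two_generators)
  qed
  then obtain e where e: "\<And>x. x \<in> F \<Longrightarrow> e x \<in> \<O>" "\<And>x. x \<in> F \<Longrightarrow> \<exists>r\<in>\<O>. e x * z = r * x"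
    "\<And>x. x \<in> F \<Longrightarrow> \<exists>r'\<in>\<O>. (1 - e x) * x = r' * z" by metis
  \<comment> \<open>Each weight \<open>g x\<close> is split into a share \<open>g x * e x\<close>
    kept by \<open>x\<close> and a share \<open>g x * (1 - e x)\<close> passed on to
    \<open>z\<close>.\<close>
  define h where "h = (\<lambda>x. if x = z then \<Sum>x\<in>F. g x * (1 - e x) else g x * e x)"
  have hz: "h z = (\<Sum>x\<in>F. g x * (1 - e x))" by (simp add: h_def)
  have hF: "h x = g x * e x" if "x \<in> F" for x using that insert.hyps by (auto simp: h_def)
  have "sum h (insert z F) = (\<Sum>x\<in>F. g x * (1 - e x)) + (\<Sum>x\<in>F. g x * e x)"
    using insert.hyps hz hF by simp
  also have "\<dots> = 1" using g(2) by (simp add: sum.distrib[symmetric] algebra_simps)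
  finally have "sum h (insert z F) = 1" .
  moreover have "h x \<in> \<O>" if "x \<in> insert z F" for x
    using that hz hF g(1) e(1) by (auto intro!: O_sum)
  moreover have "\<exists>r\<in>\<O>. h x * y = r * x" if "x \<in> insert z F" "y \<in> insert z F" for x y
  proof (cases "x = z")
    case False
    hence x: "x \<in> F" using that by auto
    show ?thesis
    proof (cases "y = z")
      case True
      obtain r where "r \<in> \<O>" "e x * z = r * x" using e(2)[OF x] by auto
      hence "h x * y = (g x * r) * x" using True by (simp add: hF[OF x] mult.assoc)
      thus ?thesis using g(1)[OF x] \<open>r \<in> \<O>\<close> by blast
    next
      case False
      then obtain r where "r \<in> \<O>" "g x * y = r * x" using g(3)[OF x, of y] \<open>y \<in> insert z F\<close> by blast
      hence "h x * y = (e x * r) * x" by (simp add: hF[OF x] mult_ac)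
      thus ?thesis using e(1)[OF x] \<open>r \<in> \<O>\<close> by blast
    qed
  next
    case True
    \<comment> \<open>Goes through \<open>u\<close>: \<open>g u * y\<close> is a multiple of
      \<open>u\<close>, and \<open>(1 - e u) * u\<close> is a multiple of \<open>z\<close>.\<close>
    have "\<exists>r\<in>\<O>. g u * (1 - e u) * y = r * z" if u: "u \<in> F" for u
    proof (cases "y = z")
      case True
      thus ?thesis using g(1)[OF u] e(1)[OF u] by blast
    next
      case False
      then obtain r where r: "r \<in> \<O>" "g u * y = r * u" using g(3)[OF u, of y] \<open>y \<in> insert z F\<close> by blast
      obtain r' where r': "r' \<in> \<O>" "(1 - e u) * u = r' * z" using e(3)[OF u] by auto
      have "g u * (1 - e u) * y = (1 - e u) * (g u * y)" by (simp add: mult_ac)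
      also have "\<dots> = r * ((1 - e u) * u)" using r by (simp add: mult_ac)
      also have "\<dots> = (r * r') * z" using r' by (simp add: mult_ac)
      finally show ?thesis using r r' by blast
    qed
    then obtain r where r: "\<And>u. u \<in> F \<Longrightarrow> r u \<in> \<O>" "\<And>u. u \<in> F \<Longrightarrow> g u * (1 - e u) * y = r u * z"
      by metis
    have "h x * y = (\<Sum>u\<in>F. r u) * x"
      unfolding True hz sum_distrib_right using r by (intro sum.cong) auto
    thus ?thesis using r by blast
  qed
  ultimately show ?case by blast
qed

section \<open>Finite generation of fractional ideals\<close>

lemma int_multiple_integral:
  assumes "z \<in> K"
  obtains m :: int where "m \<noteq> 0" "of_int m * z \<in> \<O>"
proof -
  obtain d :: nat where d: "\<And>f. (\<And>i. i \<le> d \<Longrightarrow> f i \<in> K) \<Longrightarrow>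
    \<exists>c::nat \<Rightarrow> int. (\<exists>i\<le>d. c i \<noteq> 0) \<and> (\<Sum>i\<le>d. of_int (c i) * f i) = 0"
    using int_relation by blast
  obtain c :: "nat \<Rightarrow> int" where c: "\<exists>i\<le>d. c i \<noteq> 0" "(\<Sum>i\<le>d. of_int (c i) * z ^ i) = 0"
    using d[of "\<lambda>i. z ^ i"] assms by auto
  \<comment> \<open>The last nonzero coefficient is the multiplier that makes \<open>z\<close>
    integral.\<close>
  obtain n where n: "n \<le> d" "c n \<noteq> 0" "\<And>i. i \<le> d \<Longrightarrow> c i \<noteq> 0 \<Longrightarrow> i \<le> n"
    using Nat.ex_has_greatest_nat[of "\<lambda>i. i \<le> d \<and> c i \<noteq> 0" _ d] c(1) by blast
  have "(\<Sum>i\<le>n. of_int (c i) * z ^ i) = (\<Sum>i\<le>d. of_int (c i) * z ^ i)"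
    using n by (intro sum.mono_neutral_left) force+
  hence "algebraic_int (of_int (c n) * z)"
    using c(2) by (intro algebraic_int_lead_coeff_mult[where c = "\<lambda>i. of_int (c i)"]) auto
  thus ?thesis using that[of "c n"] n(2) assms by (auto simp: \<O>_def)
qed

text \<open>More than \<open>rank\<close> elements of \<open>\<O>\<close> are dependent modulo every prime \<open>p\<close>, so that
  subgroups between \<open>p\<O>\<close> and \<open>\<O>\<close> are finitely generated modulo \<open>p\<O>\<close>.\<close>

lemma finitely_generated_mod_prime:
  fixes p :: int
  assumes p: "prime p" and H: "int_module.subspace H" "H \<subseteq> \<O>"
  obtains F where "finite F" "F \<subseteq> H" "\<And>y. y \<in> H \<Longrightarrow> \<exists>u\<in>int_span F. \<exists>w\<in>\<O>. y = u + of_int p * w"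
proof -
  obtain d :: nat where d: "\<And>f. (\<And>i. i \<le> d \<Longrightarrow> f i \<in> K) \<Longrightarrow>
    \<exists>c::nat \<Rightarrow> int. Gcd (c ` {..d}) = 1 \<and> (\<Sum>i\<le>d. of_int (c i) * f i) = 0"
    using primitive_int_relation by blast
  \<comment> \<open>Independence over the field with \<open>p\<close> elements of the classes modulo
    \<open>p\<O>\<close>, expressed by integer coefficients.\<close>
  define indep where "indep = (\<lambda>k h. (\<forall>i<k. h i \<in> H) \<and>
    (\<forall>c::nat \<Rightarrow> int. (\<exists>w\<in>\<O>. (\<Sum>i<k. of_int (c i) * h i) = of_int p * w) \<longrightarrow> (\<forall>i<k. p dvd c i)))"
  have bound: "k \<le> d" if "indep k h" for k h
  proof (rule ccontr)
    assume k: "\<not> k \<le> d"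
    have "h i \<in> K" if "i \<le> d" for i
      using \<open>indep k h\<close> that k H(2) by (force simp: indep_def)
    then obtain c :: "nat \<Rightarrow> int" where c: "Gcd (c ` {..d}) = 1" "(\<Sum>i\<le>d. of_int (c i) * h i) = 0"
      using d by blast
    define c' where "c' = (\<lambda>i. if i \<le> d then c i else 0)"
    have "(\<Sum>i<k. of_int (c' i) * h i) = (\<Sum>i\<le>d. of_int (c i) * h i)"
      using k by (intro sum.mono_neutral_cong_right) (auto simp: c'_def)
    also have "\<dots> = of_int p * 0" using c(2) by simp
    finally have "\<forall>i<k. p dvd c' i"
      using \<open>indep k h\<close> O_closed(1) unfolding indep_def by blast
    hence "p dvd c i" if "i \<le> d" for i
    proof -
      have "i < k" using that k by simp
      thus ?thesis using \<open>\<forall>i<k. p dvd c' i\<close> that by (auto simp: c'_def)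
    qed
    hence "p dvd Gcd (c ` {..d})" by (auto intro: Gcd_greatest)
    thus False using c(1) p by (simp add: not_prime_unit)
  qed
  have "indep 0 (\<lambda>_. 0)" by (simp add: indep_def)
  then obtain k where k: "\<exists>h. indep k h" "\<And>k'. \<exists>h. indep k' h \<Longrightarrow> k' \<le> k"
    using Nat.ex_has_greatest_nat[of "\<lambda>k. \<exists>h. indep k h" 0 d] bound by blast
  then obtain h where h: "indep k h" by blast
  define F where "F = h ` {..<k}"
  show ?thesis
  proof (rule that)
    show "finite F" by (simp add: F_def)
    show "F \<subseteq> H" using h by (auto simp: F_def indep_def)
    fix y assume y: "y \<in> H"
    define h' where "h' = h(k := y)"
    have h'H: "\<forall>i<Suc k. h' i \<in> H" using h y by (auto simp: h'_def indep_def less_Suc_eq)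
    have "\<not> indep (Suc k) h'" using k(2)[of "Suc k"] by auto
    then obtain c :: "nat \<Rightarrow> int" and w where c: "w \<in> \<O>" "(\<Sum>i<Suc k. of_int (c i) * h' i) = of_int p * w"
      "\<not> (\<forall>i<Suc k. p dvd c i)"
      using h'H unfolding indep_def by blast
    define S where "S = (\<Sum>i<k. of_int (c i) * h i)"
    have S: "S + of_int (c k) * y = of_int p * w"
      using c(2) by (simp add: h'_def S_def)
    have Sspan: "S \<in> int_span F"
      unfolding S_def F_def
      by (intro int_module.span_sum int_module.span_scale int_module.span_base) auto
    \<comment> \<open>Otherwise the other terms would contradict the independence of
      \<open>h\<close>. The coefficient of \<open>y\<close> is thus invertible modulo
      \<open>p\<close>, and the relation can be solved for \<open>y\<close>.\<close>
    have "\<not> p dvd c k"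
    proof
      assume "p dvd c k"
      then obtain e where e: "c k = p * e" by (auto simp: dvd_def)
      have "S = of_int p * (w - of_int e * y)"
        using S by (simp add: e algebra_simps eq_diff_eq)
      moreover have "w - of_int e * y \<in> \<O>" using c(1) y H(2) by auto
      ultimately have "\<forall>i<k. p dvd c i"
        using h unfolding indep_def S_def by blast
      thus False using c(3) \<open>p dvd c k\<close> by (auto simp: less_Suc_eq)
    qed
    hence "gcd (c k) p = 1"
      using p prime_imp_coprime[of p "c k"] by (simp add: coprime_iff_gcd_eq_1 gcd.commute)
    then obtain u v where uv: "u * c k + v * p = 1"
      using bezout_int[of "c k" p] by auto
    have "y = of_int (u * c k + v * p) * y" by (simp add: uv)
    also have "\<dots> = of_int u * (of_int (c k) * y) + of_int p * (of_int v * y)"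
      by (simp add: algebra_simps)
    also have "of_int (c k) * y = of_int p * w - S"
      using S by (simp add: eq_diff_eq add.commute)
    finally have "y = of_int (- u) * S + of_int p * (of_int u * w + of_int v * y)"
      by (simp add: algebra_simps)
    moreover have "of_int (- u) * S \<in> int_span F"
      using Sspan by (rule int_module.span_scale)
    moreover have "of_int u * w + of_int v * y \<in> \<O>" using c(1) y H(2) by auto
    ultimately show "\<exists>u\<in>int_span F. \<exists>w\<in>\<O>. y = u + of_int p * w" by blast
  qed
qed

text \<open>Splits off one prime \<open>p\<close> at a time. The remainder \<open>w\<close> left
  modulo \<open>n\<close> lies in the subgroup \<open>H'\<close>, which is generated modulo
  \<open>p\<close>; multiplication by \<open>n\<close> carries these generators into
  \<open>H\<close>.\<close>

lemma finitely_generated_mod_int: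
  fixes n :: int
  assumes "n \<noteq> 0" "int_module.subspace H" "H \<subseteq> \<O>"
  shows "\<exists>F. finite F \<and> F \<subseteq> H \<and> (\<forall>y\<in>H. \<exists>u\<in>int_span F. \<exists>w\<in>\<O>. y = u + of_int n * w)"
  using assms
proof (induction n arbitrary: H rule: prime_divisors_induct)
  case (unit n)
  hence n: "n * n = 1" by (auto simp: zdvd1_eq abs_if split: if_splits)
  have "y = 0 + of_int n * (of_int n * y)" for y :: 'a
    using n by (simp flip: mult.assoc of_int_mult)
  moreover have "of_int n * y \<in> \<O>" if "y \<in> H" for y using unit.prems that by auto
  ultimately show ?case
    using int_module.span_zero by (intro exI[of _ "{}"]) blast
next
  case (factor p n)
  have Osub: "int_module.subspace \<O>" by (auto simp: int_module.subspace_def)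
  have n: "n \<noteq> 0" using factor.prems by auto
  obtain F1 where F1: "finite F1" "F1 \<subseteq> H" "\<And>y. y \<in> H \<Longrightarrow> \<exists>u\<in>int_span F1. \<exists>w\<in>\<O>. y = u + of_int n * w"
    using factor.IH[OF n factor.prems(2,3)] by blast
  define H' where "H' = {w \<in> \<O>. of_int n * w \<in> H}"
  have H': "H' = \<O> \<inter> {w. of_int n * w \<in> H}" by (auto simp: H'_def)
  have "int_module.subspace H'" unfolding H'
    by (intro int_module.subspace_inter Osub int_subspace_vimage_mult factor.prems(2))
  then obtain F2 where F2: "finite F2" "F2 \<subseteq> H'"
    "\<And>y. y \<in> H' \<Longrightarrow> \<exists>u\<in>int_span F2. \<exists>w\<in>\<O>. y = u + of_int p * w"
    using finitely_generated_mod_prime[OF factor.hyps(1), of H'] by (auto simp: H'_def)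
  define F where "F = F1 \<union> (\<lambda>x. of_int n * x) ` F2"
  have F_sub: "int_module.subspace (int_span F)" by simp
  have span1: "int_span F1 \<subseteq> int_span F" by (intro int_module.span_mono) (auto simp: F_def)
  have span2: "of_int n * u \<in> int_span F" if "u \<in> int_span F2" for u
  proof -
    have "int_span F2 \<subseteq> {u. of_int n * u \<in> int_span F}"
      by (intro int_module.span_minimal int_subspace_vimage_mult F_sub)
         (auto simp: F_def intro!: int_module.span_base)
    thus ?thesis using that by auto
  qed
  have span_H: "int_span F1 \<subseteq> H" by (intro int_module.span_minimal F1 factor.prems)
  have "\<exists>u\<in>int_span F. \<exists>w\<in>\<O>. y = u + of_int (p * n) * w" if y: "y \<in> H" for y
  proof -
    obtain u w where uw: "u \<in> int_span F1" "w \<in> \<O>" "y = u + of_int n * w" using F1(3)[OF y] by blast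
    have "of_int n * w = y - u" using uw by simp
    hence "w \<in> H'" using uw y span_H int_module.subspace_diff[OF factor.prems(2), of y u] by (auto simp: H'_def)
    then obtain u' w' where uw': "u' \<in> int_span F2" "w' \<in> \<O>" "w = u' + of_int p * w'" using F2(3) by blast
    have "y = (u + of_int n * u') + of_int (p * n) * w'" using uw uw' by (simp add: algebra_simps)
    moreover have "u + of_int n * u' \<in> int_span F"
      using span1 span2[OF uw'(1)] uw(1) by (intro int_module.span_add) auto
    ultimately show ?thesis using uw' by blast
  qed
  moreover have "finite F" "F \<subseteq> H" using F1 F2 by (auto simp: F_def H'_def)
  ultimately show ?case by blast
qed auto

text \<open>Denominators are not bounded. Inside \<open>\<O>\<close> these are the integral ideals,
  the zero ideal included.\<close>

definition O_module :: "'a set \<Rightarrow> bool"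
  where "O_module M \<longleftrightarrow> M \<subseteq> K \<and> 0 \<in> M \<and> (\<forall>x\<in>M. \<forall>y\<in>M. x + y \<in> M) \<and> (\<forall>r\<in>\<O>. \<forall>x\<in>M. r * x \<in> M)"

lemma O_moduleI:
  assumes "M \<subseteq> K" "0 \<in> M" "\<And>x y. x \<in> M \<Longrightarrow> y \<in> M \<Longrightarrow> x + y \<in> M"
    "\<And>r x. r \<in> \<O> \<Longrightarrow> x \<in> M \<Longrightarrow> r * x \<in> M"
  shows "O_module M"
  using assms by (auto simp: O_module_def)

lemma O_moduleD:
  assumes "O_module M"
  shows "M \<subseteq> K" "x \<in> M \<Longrightarrow> x \<in> K" "0 \<in> M" "x \<in> M \<Longrightarrow> y \<in> M \<Longrightarrow> x + y \<in> M"
    "r \<in> \<O> \<Longrightarrow> x \<in> M \<Longrightarrow> r * x \<in> M"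
  using assms by (auto simp: O_module_def)

lemma O_module_sum:
  assumes "O_module M" "\<And>i. i \<in> A \<Longrightarrow> f i \<in> M"
  shows "sum f A \<in> M"
  using assms(2) by (induction A rule: infinite_finite_induct) (auto intro: O_moduleD[OF assms(1)])

lemma O_module_imp_subspace: "O_module M \<Longrightarrow> int_module.subspace M"
  using O_moduleD(3-5) by (auto simp: int_module.subspace_def)

text \<open>Since \<open>M\<close> contains \<open>n\<O>\<close>, generators modulo \<open>n\<close>
  together with \<open>n\<close> itself suffice.\<close>

lemma integral_ideal_finitely_generated:
  assumes M: "O_module M" "M \<subseteq> \<O>" and n: "of_int n \<in> M" "n \<noteq> 0"
  obtains F where "finite F" "F \<subseteq> M"
    "\<And>y. y \<in> M \<Longrightarrow> \<exists>c. (\<forall>x\<in>F. c x \<in> \<O>) \<and> y = (\<Sum>x\<in>F. c x * x)"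
proof -
  obtain F where F: "finite F" "F \<subseteq> M"
    "\<And>y. y \<in> M \<Longrightarrow> \<exists>u\<in>int_span F. \<exists>w\<in>\<O>. y = u + of_int n * w"
    using finitely_generated_mod_int[OF n(2) O_module_imp_subspace[OF M(1)] M(2)] by blast
  show ?thesis
  proof (rule that)
    show "finite (insert (of_int n) F)" "insert (of_int n) F \<subseteq> M" using F n by auto
    fix y assume "y \<in> M"
    then obtain u w where uw: "u \<in> int_span F" "w \<in> \<O>" "y = u + of_int n * w" using F(3) by blast
    obtain c where c: "u = (\<Sum>x\<in>F. of_int (c x) * x)" using int_span_finiteE[OF F(1) uw(1)] .
    \<comment> \<open>The two contributions are added because \<open>of_int n\<close> may already
      belong to \<open>F\<close>.\<close>
    define c' :: "'a \<Rightarrow> 'a" where "c' = (\<lambda>x. (if x \<in> F then of_int (c x) else 0) + (if x = of_int n then w else 0))"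
    have "(\<Sum>x\<in>insert (of_int n) F. c' x * x) =
      (\<Sum>x\<in>insert (of_int n) F. (if x \<in> F then of_int (c x) else 0) * x) +
      (\<Sum>x\<in>insert (of_int n) F. (if x = of_int n then w else 0) * x)"
      by (simp add: c'_def distrib_right sum.distrib)
    also have "(\<Sum>x\<in>insert (of_int n) F. (if x \<in> F then of_int (c x) else 0) * x) = u"
      unfolding c using F(1) by (intro sum.mono_neutral_cong_right) auto
    also have "(\<Sum>x\<in>insert (of_int n) F. (if x = of_int n then w else 0) * x) =
       (\<Sum>x\<in>{of_int n}. w * x)"
      using F(1) by (intro sum.mono_neutral_cong_right) auto
    finally have "y = (\<Sum>x\<in>insert (of_int n) F. c' x * x)" using uw by (simp add: mult.commute)
    moreover have "\<forall>x\<in>insert (of_int n) F. c' x \<in> \<O>" using uw by (auto simp: c'_def)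
    ultimately show "\<exists>c. (\<forall>x\<in>insert (of_int n) F. c x \<in> \<O>) \<and> y = (\<Sum>x\<in>insert (of_int n) F. c x * x)"
      by blast
  qed
qed

text \<open>Multiplication by \<open>d\<close> moves \<open>M\<close> into \<open>\<O>\<close>; the
  generators found there are divided by \<open>d\<close>.\<close>

lemma fractional_ideal_finitely_generated:
  assumes M: "O_module M" and x: "x \<in> M" "x \<noteq> 0" and d: "d \<in> K" "d \<noteq> 0" "\<And>y. y \<in> M \<Longrightarrow> d * y \<in> \<O>"
  obtains F where "finite F" "F \<subseteq> M"
    "\<And>y. y \<in> M \<Longrightarrow> \<exists>c. (\<forall>x\<in>F. c x \<in> \<O>) \<and> y = (\<Sum>x\<in>F. c x * x)"
proof -
  define N where "N = (\<lambda>y. d * y) ` M"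
  have N: "O_module N"
  proof (rule O_moduleI)
    show "r * y \<in> N" if ry: "r \<in> \<O>" "y \<in> N" for r y
    proof -
      obtain y' where "y' \<in> M" "y = d * y'" using ry unfolding N_def by blast
      hence "r * y = d * (r * y')" "r * y' \<in> M" using O_moduleD(5)[OF M] ry by (auto simp: mult_ac)
      thus ?thesis unfolding N_def by blast
    qed
    show "y + z \<in> N" if yz: "y \<in> N" "z \<in> N" for y z
    proof -
      obtain y' z' where "y' \<in> M" "y = d * y'" "z' \<in> M" "z = d * z'" using yz unfolding N_def by blast
      hence "y + z = d * (y' + z')" "y' + z' \<in> M" using O_moduleD(4)[OF M] by (auto simp: distrib_left)
      thus ?thesis unfolding N_def by blast
    qed
  qed (use O_moduleD[OF M] d in \<open>auto simp: N_def image_iff intro!: bexI[of _ 0]\<close>)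
  \<comment> \<open>Leads to a nonzero integer \<open>m\<close> in \<open>N\<close>, as an integral
    multiple of \<open>d * x\<close>.\<close>
  have "inverse (d * x) \<in> K" using d x O_moduleD[OF M] by auto
  then obtain m :: int where m: "m \<noteq> 0" "of_int m * inverse (d * x) \<in> \<O>"
    using int_multiple_integral by blast
  have "of_int m = (of_int m * inverse (d * x)) * (d * x)" using d(2) x(2) by (metis left_inverse mult.assoc mult.right_neutral mult_eq_0_iff)
  moreover have "(of_int m * inverse (d * x)) * (d * x) \<in> N"
    using O_moduleD(5)[OF N m(2)] x by (auto simp: N_def)
  ultimately have "of_int m \<in> N" by metis
  moreover have "N \<subseteq> \<O>" using d by (auto simp: N_def)
  ultimately obtain G where G: "finite G" "G \<subseteq> N"
    "\<And>y. y \<in> N \<Longrightarrow> \<exists>c. (\<forall>x\<in>G. c x \<in> \<O>) \<and> y = (\<Sum>x\<in>G. c x * x)"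
    using integral_ideal_finitely_generated[OF N _ _ m(1)] by metis
  define F where "F = (\<lambda>y. y / d) ` G"
  have inj: "inj_on (\<lambda>y. y / d) G" using d by (auto simp: inj_on_def)
  show ?thesis
  proof (rule that)
    show "finite F" using G by (simp add: F_def)
    show "F \<subseteq> M" using G(2) d by (auto simp: F_def N_def)
    fix y assume "y \<in> M"
    hence "d * y \<in> N" by (auto simp: N_def)
    then obtain c where c: "\<forall>x\<in>G. c x \<in> \<O>" "d * y = (\<Sum>x\<in>G. c x * x)" using G(3) by blast
    have "y = (d * y) / d" using d by simp
    also have "\<dots> = (\<Sum>x\<in>G. c x * (x / d))" by (simp add: c(2) sum_divide_distrib)
    also have "\<dots> = (\<Sum>x\<in>F. c (d * x) * x)"
      unfolding F_def using d by (simp add: sum.reindex[OF inj])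
    finally show "\<exists>c. (\<forall>x\<in>F. c x \<in> \<O>) \<and> y = (\<Sum>x\<in>F. c x * x)"
      using c(1) d by (intro exI[of _ "\<lambda>x. c (d * x)"]) (auto simp: F_def)
  qed
qed

text \<open>The weights are \<open>g x / x\<close> with \<open>g\<close> from
  \<open>finitely_many_generators\<close>. They lie in the inverse of \<open>M\<close>; the
  generator 0 is dropped to allow the division.\<close>

lemma fractional_ideal_partition_of_unity:
  assumes M: "O_module M" and x: "x \<in> M" "x \<noteq> 0" and d: "d \<in> K" "d \<noteq> 0" "\<And>y. y \<in> M \<Longrightarrow> d * y \<in> \<O>"
  obtains F p where "finite F" "F \<subseteq> M" "\<And>x. x \<in> F \<Longrightarrow> p x \<in> K"
    "\<And>x y. x \<in> F \<Longrightarrow> y \<in> M \<Longrightarrow> p x * y \<in> \<O>" "(\<Sum>x\<in>F. x * p x) = 1"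
proof -
  obtain F0 where F0: "finite F0" "F0 \<subseteq> M"
    "\<And>y. y \<in> M \<Longrightarrow> \<exists>c. (\<forall>x\<in>F0. c x \<in> \<O>) \<and> y = (\<Sum>x\<in>F0. c x * x)"
    using fractional_ideal_finitely_generated[OF assms] by metis
  define F where "F = F0 - {0}"
  have gen: "\<exists>c. (\<forall>x\<in>F. c x \<in> \<O>) \<and> y = (\<Sum>x\<in>F. c x * x)" if y: "y \<in> M" for y
  proof -
    obtain c where c: "\<forall>x\<in>F0. c x \<in> \<O>" "y = (\<Sum>x\<in>F0. c x * x)" using F0(3)[OF y] by blast
    have "(\<Sum>x\<in>F0. c x * x) = (\<Sum>x\<in>F. c x * x)"
      unfolding F_def using F0(1) by (intro sum.mono_neutral_right) auto
    thus ?thesis using c by (intro exI[of _ c]) (auto simp: F_def)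
  qed
  have "F \<noteq> {}" using gen[OF x(1)] x(2) by auto
  moreover have "F \<subseteq> K - {0}" using F0(2) O_moduleD(1)[OF M] by (auto simp: F_def)
  moreover have fin: "finite F" using F0 by (simp add: F_def)
  ultimately obtain g where g: "\<And>x. x \<in> F \<Longrightarrow> g x \<in> \<O>" "sum g F = 1"
    "\<And>x y. x \<in> F \<Longrightarrow> y \<in> F \<Longrightarrow> \<exists>r\<in>\<O>. g x * y = r * x"
    using finitely_many_generators by metis
  show ?thesis
  proof (rule that[of F "\<lambda>x. g x / x"])
    show "F \<subseteq> M" using F0 by (auto simp: F_def)
    show "g x / x \<in> K" if "x \<in> F" for x
      using g(1)[OF that] that \<open>F \<subseteq> K - {0}\<close> by auto
    have "(\<Sum>x\<in>F. x * (g x / x)) = sum g F"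
      by (intro sum.cong) (auto simp: F_def)
    thus "(\<Sum>x\<in>F. x * (g x / x)) = 1" using g by simp
    fix x y assume xy: "x \<in> F" "y \<in> M"
    have *: "g x / x * z \<in> \<O>" if "z \<in> F" for z
    proof -
      obtain r where "r \<in> \<O>" "g x * z = r * x" using g(3)[OF xy(1) \<open>z \<in> F\<close>] by blast
      thus ?thesis using xy(1) by (simp add: F_def)
    qed
    obtain c where c: "\<forall>z\<in>F. c z \<in> \<O>" "y = (\<Sum>z\<in>F. c z * z)" using gen[OF xy(2)] by blast
    have "g x / x * y = (\<Sum>z\<in>F. c z * (g x / x * z))"
      unfolding c(2) sum_distrib_left by (intro sum.cong) (auto simp: mult_ac)
    also have "\<dots> \<in> \<O>" using c(1) * O_closed(6) by (intro O_sum) blast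
    finally show "g x / x * y \<in> \<O>" .
  qed (rule fin)
qed

text \<open>This is why the square of a fractional ideal is generated by squares of elements.\<close>

lemma product_in_module_if_squares:
  assumes N: "O_module N" and "x \<in> K" "y \<in> K" "x ^ 2 \<in> N" "y ^ 2 \<in> N"
  shows "x * y \<in> N"
proof (cases "x = 0")
  case True
  thus ?thesis using O_moduleD(3)[OF N] by simp
next
  case False
  obtain e r r' where e: "e \<in> \<O>" "r \<in> \<O>" "r' \<in> \<O>" "e * y = r * x" "(1 - e) * x = r' * y"
    using two_generators[OF assms(2,3) False] .
  have "x * y = x * (e * y) + (1 - e) * x * y" by (simp add: algebra_simps)
  also have "\<dots> = r * x ^ 2 + r' * y ^ 2" unfolding e(4,5) by (simp add: power2_eq_square)
  also have "\<dots> \<in> N" using assms e O_moduleD[OF N] by auto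
  finally show ?thesis .
qed


subsection \<open>The group of fractional ideals\<close>

abbreviation module_prod :: "'a set \<Rightarrow> 'a set \<Rightarrow> 'a set" (infixl "\<odot>" 75)
  where "M \<odot> N \<equiv> ideal_prod ambient M N"

lemma carrier_ring_of_integers: "carrier (ring_of_integers K) = \<O>"
  by (simp add: ring_of_integers_def \<O>_def)

lemma mem_inverse_ideal_iff: "x \<in> inverse_ideal K M \<longleftrightarrow> x \<in> K \<and> (\<forall>y\<in>M. x * y \<in> \<O>)"
  by (simp add: inverse_ideal_def carrier_ring_of_integers)

lemma inverse_idealD: "x \<in> inverse_ideal K M \<Longrightarrow> y \<in> M \<Longrightarrow> x * y \<in> \<O>"
  by (simp add: mem_inverse_ideal_iff)

lemma O_module_O: "O_module \<O>"
  by (intro O_moduleI) auto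

lemma O_module_inverse: "O_module M \<Longrightarrow> O_module (inverse_ideal K M)"
  by (intro O_moduleI)
     (auto simp: mem_inverse_ideal_iff distrib_right mult.assoc intro: O_imp_K)

lemma module_prodI: "x \<in> M \<Longrightarrow> y \<in> N \<Longrightarrow> x * y \<in> M \<odot> N"
  using ideal_prod.prod[of x M y N ambient] by simp

lemma module_prod_add: "x \<in> M \<odot> N \<Longrightarrow> y \<in> M \<odot> N \<Longrightarrow> x + y \<in> M \<odot> N"
  using ideal_prod.sum[of x ambient M N y] by simp

lemma module_prod_subset:
  assumes "\<And>x y. x \<in> P \<Longrightarrow> y \<in> P \<Longrightarrow> x + y \<in> P" "\<And>x y. x \<in> M \<Longrightarrow> y \<in> N \<Longrightarrow> x * y \<in> P"
  shows "M \<odot> N \<subseteq> P"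
proof
  fix z assume "z \<in> M \<odot> N"
  thus "z \<in> P" by induction (use assms in simp_all)
qed

lemma module_prod_subset_module:
  assumes "O_module P" "\<And>x y. x \<in> M \<Longrightarrow> y \<in> N \<Longrightarrow> x * y \<in> P"
  shows "M \<odot> N \<subseteq> P"
  using assms by (intro module_prod_subset) (auto intro: O_moduleD)

lemma module_prod_mono: "M \<subseteq> M' \<Longrightarrow> N \<subseteq> N' \<Longrightarrow> M \<odot> N \<subseteq> M' \<odot> N'"
  by (intro module_prod_subset) (auto intro: module_prodI module_prod_add)

lemma module_prod_commute: "M \<odot> N = N \<odot> M"
proof -
  have "M \<odot> N \<subseteq> N \<odot> M" for M N
    by (rule module_prod_subset[OF module_prod_add]) (metis mult.commute module_prodI)+
  thus ?thesis by blast
qed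

lemma O_module_prod:
  assumes "O_module M" "O_module N"
  shows "O_module (M \<odot> N)"
proof (rule O_moduleI)
  show "M \<odot> N \<subseteq> K"
    using O_moduleD(2)[OF assms(1)] O_moduleD(2)[OF assms(2)] by (intro module_prod_subset) auto
  show "0 \<in> M \<odot> N" using module_prodI[of 0 M 0 N] O_moduleD(3) assms by simp
  show "x + y \<in> M \<odot> N" if "x \<in> M \<odot> N" "y \<in> M \<odot> N" for x y
    using that by (rule module_prod_add)
  show "r * x \<in> M \<odot> N" if "r \<in> \<O>" "x \<in> M \<odot> N" for r x
  proof -
    have "M \<odot> N \<subseteq> {x. r * x \<in> M \<odot> N}"
      using O_moduleD(5)[OF assms(1) that(1)]
      by (intro module_prod_subset)
         (auto simp: distrib_left mult.assoc[symmetric] intro: module_prodI module_prod_add)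
    thus ?thesis using that by auto
  qed
qed

lemma module_prod_assoc: "M \<odot> N \<odot> P = M \<odot> (N \<odot> P)"
proof
  show "M \<odot> N \<odot> P \<subseteq> M \<odot> (N \<odot> P)"
  proof (rule module_prod_subset[OF module_prod_add])
    fix x y assume "x \<in> M \<odot> N" and y: "y \<in> P"
    have "M \<odot> N \<subseteq> {x. x * y \<in> M \<odot> (N \<odot> P)}"
      using y by (intro module_prod_subset)
        (auto simp: distrib_right mult.assoc intro: module_prodI module_prod_add)
    thus "x * y \<in> M \<odot> (N \<odot> P)" using \<open>x \<in> M \<odot> N\<close> by auto
  qed
  show "M \<odot> (N \<odot> P) \<subseteq> M \<odot> N \<odot> P"
  proof (rule module_prod_subset[OF module_prod_add])
    fix x y assume x: "x \<in> M" and "y \<in> N \<odot> P"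
    have "N \<odot> P \<subseteq> {y. x * y \<in> M \<odot> N \<odot> P}"
      using x by (intro module_prod_subset)
        (auto simp: distrib_left mult.assoc[symmetric] intro: module_prodI module_prod_add)
    thus "x * y \<in> M \<odot> N \<odot> P" using \<open>y \<in> N \<odot> P\<close> by auto
  qed
qed

lemma module_prod_left_commute: "M \<odot> (N \<odot> P) = N \<odot> (M \<odot> P)"
  by (metis module_prod_assoc module_prod_commute)

lemmas module_prod_ac = module_prod_assoc module_prod_commute module_prod_left_commute

lemma module_prod_O [simp]:
  assumes "O_module M"
  shows "\<O> \<odot> M = M" "M \<odot> \<O> = M"
proof -
  show "\<O> \<odot> M = M"
  proof
    show "\<O> \<odot> M \<subseteq> M" by (intro module_prod_subset_module assms O_moduleD(5)[OF assms])
    show "M \<subseteq> \<O> \<odot> M" using module_prodI[OF O_closed(2), of _ M] by auto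
  qed
  thus "M \<odot> \<O> = M" by (simp add: module_prod_commute)
qed

lemma module_prod_integral:
  assumes "M \<subseteq> \<O>" "O_module N"
  shows "M \<odot> N \<subseteq> N"
  using module_prod_mono[OF assms(1) subset_refl, of N] assms(2) by simp

text \<open>Mixed products follow from squares by \<open>product_in_module_if_squares\<close>.
  Integrality of norms, which controls only squares, thereby yields statements about products of
  ideals.\<close>

lemma squares_imp_module_prod_subset:
  assumes "O_module M" "O_module N" "\<And>x. x \<in> M \<Longrightarrow> x ^ 2 \<in> N"
  shows "M \<odot> M \<subseteq> N"
  using assms O_moduleD(2)[OF assms(1)]
  by (intro module_prod_subset_module product_in_module_if_squares) auto

definition invertible :: "'a set \<Rightarrow> bool"
  where "invertible M \<longleftrightarrow> O_module M \<and> M \<odot> inverse_ideal K M = \<O>"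

lemma invertible_imp_O_module: "invertible M \<Longrightarrow> O_module M"
  by (simp add: invertible_def)

lemma prod_inverse_ideal:
  assumes "invertible M"
  shows "M \<odot> inverse_ideal K M = \<O>" "inverse_ideal K M \<odot> M = \<O>"
  using assms by (auto simp: invertible_def module_prod_commute)

text \<open>\<open>N\<close> lies in the inverse because \<open>M \<odot> N\<close> is integral.
  Conversely, multiplying the inverse by \<open>M \<odot> N = \<O>\<close> and absorbing its
  integral product with \<open>M\<close> leaves a subset of \<open>N\<close>.\<close>

lemma inverse_ideal_unique:
  assumes M: "O_module M" and N: "O_module N" and eq: "M \<odot> N = \<O>"
  shows "invertible M" "inverse_ideal K M = N"
proof -
  have "x * y \<in> \<O>" if "x \<in> N" "y \<in> M" for x y
    using module_prodI[OF that(2,1)] by (simp add: eq mult.commute)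
  hence "N \<subseteq> inverse_ideal K M"
    using O_moduleD(2)[OF N] by (auto simp: mem_inverse_ideal_iff)
  moreover have "inverse_ideal K M \<odot> M \<subseteq> \<O>"
    by (intro module_prod_subset_module O_module_O) (auto simp: mem_inverse_ideal_iff)
  hence "inverse_ideal K M \<odot> M \<odot> N \<subseteq> N" using N by (rule module_prod_integral)
  hence "inverse_ideal K M \<subseteq> N" using O_module_inverse[OF M] by (simp add: module_prod_assoc eq)
  ultimately show "inverse_ideal K M = N" by blast
  thus "invertible M" using M eq by (simp add: invertible_def)
qed

lemma invertible_inverse:
  assumes "invertible M"
  shows "invertible (inverse_ideal K M)" "inverse_ideal K (inverse_ideal K M) = M"
  using inverse_ideal_unique[of "inverse_ideal K M" M] assms
  by (auto simp: prod_inverse_ideal O_module_inverse invertible_imp_O_module)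

lemma invertible_prod:
  assumes "invertible M" "invertible N"
  shows "invertible (M \<odot> N)" "inverse_ideal K (M \<odot> N) = inverse_ideal K M \<odot> inverse_ideal K N"
proof -
  have "M \<odot> N \<odot> (inverse_ideal K M \<odot> inverse_ideal K N) =
      (M \<odot> inverse_ideal K M) \<odot> (N \<odot> inverse_ideal K N)"
    by (simp add: module_prod_ac)
  hence "M \<odot> N \<odot> (inverse_ideal K M \<odot> inverse_ideal K N) = \<O>"
    using assms by (simp add: prod_inverse_ideal O_module_O)
  from inverse_ideal_unique[OF _ _ this] assms
  show "invertible (M \<odot> N)" "inverse_ideal K (M \<odot> N) = inverse_ideal K M \<odot> inverse_ideal K N"
    by (auto intro: O_module_prod O_module_inverse invertible_imp_O_module)
qed

lemma inverse_ideal_antimono: "M \<subseteq> N \<Longrightarrow> inverse_ideal K N \<subseteq> inverse_ideal K M"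
  by (auto simp: inverse_ideal_def)

lemma inverse_ideal_subset:
  assumes "invertible N" "inverse_ideal K N \<subseteq> M"
  shows "inverse_ideal K M \<subseteq> N"
  using inverse_ideal_antimono[OF assms(2)] invertible_inverse(2)[OF assms(1)] by simp

text \<open>The partition of unity exhibits 1 as a sum of products from \<open>M\<close> and its
  inverse.\<close>

lemma invertible_if_fractional:
  assumes M: "O_module M" and x: "x \<in> M" "x \<noteq> 0" and d: "d \<in> K" "d \<noteq> 0" "\<And>y. y \<in> M \<Longrightarrow> d * y \<in> \<O>"
  shows "invertible M"
proof -
  obtain F p where F: "finite F" "F \<subseteq> M" "\<And>x. x \<in> F \<Longrightarrow> p x \<in> K"
    "\<And>x y. x \<in> F \<Longrightarrow> y \<in> M \<Longrightarrow> p x * y \<in> \<O>" "(\<Sum>x\<in>F. x * p x) = 1"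
    using fractional_ideal_partition_of_unity[OF assms] by blast
  have "(\<Sum>x\<in>F. x * p x) \<in> M \<odot> inverse_ideal K M"
    using F by (intro O_module_sum O_module_prod M O_module_inverse module_prodI)
      (auto simp: mem_inverse_ideal_iff)
  hence one: "1 \<in> M \<odot> inverse_ideal K M" using F by simp
  have "r \<in> M \<odot> inverse_ideal K M" if "r \<in> \<O>" for r
    using O_moduleD(5)[OF O_module_prod[OF M O_module_inverse[OF M]] that one] by simp
  moreover have "M \<odot> inverse_ideal K M \<subseteq> \<O>"
    by (intro module_prod_subset_module O_module_O)
       (auto simp: mem_inverse_ideal_iff mult.commute)
  ultimately show ?thesis using M by (auto simp: invertible_def)
qed

text \<open>For \<open>w\<close> in the inverse of \<open>M\<close> the square of
  \<open>x * w\<close> is integral, hence so is \<open>x * w\<close>. Thus \<open>x\<close> lies in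
  the inverse of the inverse.\<close>

lemma mem_if_square_mem:
  assumes M: "invertible M" and x: "x \<in> K" "x ^ 2 \<in> M \<odot> M"
  shows "x \<in> M"
proof -
  let ?I = "inverse_ideal K M"
  have "x * w \<in> \<O>" if w: "w \<in> ?I" for w
  proof -
    have "w * w \<in> inverse_ideal K (M \<odot> M)"
      using module_prodI[OF w w] invertible_prod(2)[OF M M] by simp
    hence "(w * w) * x ^ 2 \<in> \<O>" using x by (rule_tac inverse_idealD)
    hence "(x * w) ^ 2 \<in> \<O>" by (simp add: power2_eq_square mult_ac)
    thus ?thesis using O_square_iff[of "x * w"] x w by (auto simp: mem_inverse_ideal_iff)
  qed
  hence "x \<in> inverse_ideal K ?I" using x by (simp add: mem_inverse_ideal_iff)
  thus ?thesis using invertible_inverse[OF M] by simp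
qed

section \<open>Principal fractional ideals\<close>

definition principal :: "'a \<Rightarrow> 'a set"
  where "principal a = {r * a | r. r \<in> \<O>}"

lemma mem_principalI: "r \<in> \<O> \<Longrightarrow> r * a \<in> principal a"
  by (auto simp: principal_def)

lemma self_mem_principal [simp]: "a \<in> principal a"
  using mem_principalI[OF O_closed(2)] by simp

lemma mem_principal_iff: "a \<noteq> 0 \<Longrightarrow> x \<in> principal a \<longleftrightarrow> x / a \<in> \<O>"
  by (force simp: principal_def)

lemma O_module_principal:
  assumes "a \<in> K"
  shows "O_module (principal a)"
proof (rule O_moduleI)
  show "principal a \<subseteq> K" using assms by (auto simp: principal_def)
  show "0 \<in> principal a" using mem_principalI[OF O_closed(1), of a] by simp
  show "x + y \<in> principal a" if "x \<in> principal a" "y \<in> principal a" for x y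
    using that by (auto simp: principal_def distrib_right[symmetric])
  show "r * x \<in> principal a" if "r \<in> \<O>" "x \<in> principal a" for r x
    using that by (auto simp: principal_def mult.assoc[symmetric])
qed

lemma principal_subset_iff: "O_module M \<Longrightarrow> principal a \<subseteq> M \<longleftrightarrow> a \<in> M"
  using O_moduleD(5)[of M _ a] self_mem_principal[of a] by (auto simp: principal_def)

lemma principal_1: "principal 1 = \<O>"
  by (simp add: principal_def)

lemma principal_mult:
  assumes "a \<in> K" "b \<in> K"
  shows "principal a \<odot> principal b = principal (a * b)"
proof
  show "principal a \<odot> principal b \<subseteq> principal (a * b)"
  proof (intro module_prod_subset_module O_module_principal)
    fix x y assume "x \<in> principal a" "y \<in> principal b"
    then obtain r s where "r \<in> \<O>" "s \<in> \<O>" "x = r * a" "y = s * b" by (auto simp: principal_def)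
    thus "x * y \<in> principal (a * b)"
      using mem_principalI[of "r * s" "a * b"] by (simp add: mult_ac)
  qed (use assms in auto)
  have "O_module (principal a \<odot> principal b)" using assms by (intro O_module_prod O_module_principal)
  thus "principal (a * b) \<subseteq> principal a \<odot> principal b"
    by (simp add: principal_subset_iff module_prodI)
qed

lemma invertible_principal:
  assumes "a \<in> K" "a \<noteq> 0"
  shows "invertible (principal a)" "inverse_ideal K (principal a) = principal (inverse a)"
proof -
  have "principal a \<odot> principal (inverse a) = \<O>" using assms by (simp add: principal_mult principal_1)
  from inverse_ideal_unique[OF _ _ this] assms O_module_principal
  show "invertible (principal a)" "inverse_ideal K (principal a) = principal (inverse a)" by auto
qed

lemma mem_principal_prod_iff:
  assumes "O_module M" "a \<in> K" "a \<noteq> 0"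
  shows "x \<in> principal a \<odot> M \<longleftrightarrow> x / a \<in> M"
proof
  have "principal a \<odot> M \<subseteq> {x. x / a \<in> M}"
    by (rule module_prod_subset)
       (use assms O_moduleD[OF assms(1)] in \<open>auto simp: principal_def add_divide_distrib\<close>)
  thus "x / a \<in> M" if "x \<in> principal a \<odot> M" using that by auto
  show "x \<in> principal a \<odot> M" if "x / a \<in> M"
    using module_prodI[OF self_mem_principal that, of a] assms by simp
qed

end

section \<open>The ideals attached to a square root\<close>

locale quadratic_extension = number_field_carrier +
  fixes \<Delta> \<delta> :: 'a
  assumes \<Delta>_integral: "\<Delta> \<in> \<O>" and \<Delta>_nonzero: "\<Delta> \<noteq> 0" and \<delta>_square: "\<delta> ^ 2 = \<Delta>"
begin

lemma \<Delta>_in_K [simp]: "\<Delta> \<in> K"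
  using \<Delta>_integral by auto

lemma algebraic_int_\<Delta> [simp]: "algebraic_int \<Delta>"
  using \<Delta>_integral by (simp add: \<O>_def)

lemma algebraic_int_\<delta> [simp]: "algebraic_int \<delta>"
  using algebraic_int_square_iff[of \<delta>] by (simp add: \<delta>_square)

lemma \<delta>_mult_\<delta>: "\<delta> * \<delta> = \<Delta>" "\<delta> * (\<delta> * x) = \<Delta> * x"
  by (simp_all add: \<delta>_square[symmetric] power2_eq_square)

definition \<CC> :: "'a set"
  where "\<CC> = {c \<in> K. algebraic_int (c * \<delta>)}"

definition integral_pair :: "'a \<Rightarrow> 'a \<Rightarrow> bool"
  where "integral_pair a b \<longleftrightarrow>
    a \<in> K \<and> b \<in> K \<and> algebraic_int (a + b * \<delta>) \<and> algebraic_int (a - b * \<delta>)"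

text \<open>The coefficients of \<open>\<delta>\<close> in the integers of \<open>K(\<delta>)\<close>. Requiring both \<open>a + b * \<delta>\<close> and
  \<open>a - b * \<delta>\<close> to be integral makes sense also if \<open>\<delta> \<in> K\<close>.\<close>

definition \<BB> :: "'a set"
  where "\<BB> = {b. \<exists>a. integral_pair a b}"

text \<open>Squaring moves the condition on \<open>c * \<delta>\<close> into \<open>K\<close>, and
  integrality can be tested on squares.\<close>

lemma mem_\<CC>_iff: "c \<in> \<CC> \<longleftrightarrow> c \<in> K \<and> c ^ 2 * \<Delta> \<in> \<O>"
proof -
  have "c ^ 2 * \<Delta> = (c * \<delta>) ^ 2" by (simp add: power_mult_distrib \<delta>_square)
  moreover have "c ^ 2 * \<Delta> \<in> K" if "c \<in> K" using that by simp
  ultimately show ?thesis by (auto simp: \<CC>_def \<O>_def)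
qed

text \<open>The elements \<open>a + b * \<delta>\<close> and \<open>a - b * \<delta>\<close> have
  sum \<open>2 * a\<close> and product \<open>a ^ 2 - b ^ 2 * \<Delta>\<close>, and are the roots of
  the monic quadratic with these coefficients.\<close>

lemma integral_pair_iff: "integral_pair a b \<longleftrightarrow> a \<in> K \<and> b \<in> K \<and> 2 * a \<in> \<O> \<and> a ^ 2 - b ^ 2 * \<Delta> \<in> \<O>"
proof (cases "a \<in> K \<and> b \<in> K")
  case True
  have norm: "(a + b * \<delta>) * (a - b * \<delta>) = a ^ 2 - b ^ 2 * \<Delta>"
    by (simp add: algebra_simps power2_eq_square \<delta>_mult_\<delta>)
  show ?thesis
  proof (intro iffI)
    assume "integral_pair a b"
    hence *: "algebraic_int (a + b * \<delta>)" "algebraic_int (a - b * \<delta>)"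
      by (auto simp: integral_pair_def)
    have "algebraic_int (2 * a)" using algebraic_int_add[OF *] by simp
    moreover have "algebraic_int (a ^ 2 - b ^ 2 * \<Delta>)" using algebraic_int_mult[OF *] norm by simp
    ultimately show "a \<in> K \<and> b \<in> K \<and> 2 * a \<in> \<O> \<and> a ^ 2 - b ^ 2 * \<Delta> \<in> \<O>"
      using True by (auto simp: \<O>_def)
  next
    assume "a \<in> K \<and> b \<in> K \<and> 2 * a \<in> \<O> \<and> a ^ 2 - b ^ 2 * \<Delta> \<in> \<O>"
    hence *: "algebraic_int (2 * a)" "algebraic_int (- (a ^ 2 - b ^ 2 * \<Delta>))"
      by (auto simp: \<O>_def simp del: minus_diff_eq)
    have "algebraic_int (a + b * \<delta>)"
      by (rule algebraic_int_quadratic[OF *]) (simp add: power2_eq_square algebra_simps \<delta>_mult_\<delta>)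
    moreover have "algebraic_int (a - b * \<delta>)"
      by (rule algebraic_int_quadratic[OF *]) (simp add: power2_eq_square algebra_simps \<delta>_mult_\<delta>)
    ultimately show "integral_pair a b" using True by (simp add: integral_pair_def)
  qed
qed (auto simp: integral_pair_def)

lemma integral_pair_add:
  assumes "integral_pair a b" "integral_pair a' b'"
  shows "integral_pair (a + a') (b + b')"
proof -
  have "algebraic_int ((a + b * \<delta>) + (a' + b' * \<delta>))" "algebraic_int ((a - b * \<delta>) + (a' - b' * \<delta>))"
    using assms by (auto simp: integral_pair_def)
  thus ?thesis using assms by (simp add: integral_pair_def algebra_simps)
qed

lemma integral_pair_mult:
  assumes "r \<in> \<O>" "integral_pair a b"
  shows "integral_pair (r * a) (r * b)"
proof -
  have "algebraic_int (r * (a + b * \<delta>))" "algebraic_int (r * (a - b * \<delta>))"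
    using assms by (auto simp: integral_pair_def \<O>_def)
  thus ?thesis using assms by (auto simp: integral_pair_def algebra_simps \<O>_def)
qed

lemma integral_pair_sum:
  assumes "\<And>i. i \<in> A \<Longrightarrow> integral_pair (a i) (b i)"
  shows "integral_pair (sum a A) (sum b A)"
proof -
  have "integral_pair 0 0" by (simp add: integral_pair_def)
  thus ?thesis
    using assms by (induction A rule: infinite_finite_induct) (auto intro: integral_pair_add)
qed

lemma integral_pair_0_left: "integral_pair 0 c \<longleftrightarrow> c \<in> \<CC>"
  by (auto simp: integral_pair_def \<CC>_def)

lemma \<CC>_subset_\<BB>: "\<CC> \<subseteq> \<BB>"
  using integral_pair_0_left by (auto simp: \<BB>_def)

lemma one_in_\<CC>: "1 \<in> \<CC>"
  using \<Delta>_integral by (simp add: mem_\<CC>_iff)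

text \<open>The difference of \<open>a + b * \<delta>\<close> and \<open>a - b * \<delta>\<close> is
  \<open>2 * b * \<delta>\<close>.\<close>

lemma two_mult_\<BB>: "b \<in> \<BB> \<Longrightarrow> 2 * b \<in> \<CC>"
proof -
  assume "b \<in> \<BB>"
  then obtain a where a: "algebraic_int (a + b * \<delta>)" "algebraic_int (a - b * \<delta>)" "b \<in> K"
    by (auto simp: \<BB>_def integral_pair_def)
  have "algebraic_int (2 * b * \<delta>)" using algebraic_int_diff[OF a(1,2)] by (simp add: mult_ac)
  thus ?thesis using a(3) by (simp add: \<CC>_def)
qed

text \<open>The product of \<open>c * \<delta>\<close> and \<open>\<delta>\<close> is integral. So
  \<open>\<Delta>\<close> is a common denominator of \<open>\<CC>\<close>, and
  \<open>2 * \<Delta>\<close> one of \<open>\<BB>\<close>, which makes both invertible.\<close>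

lemma \<Delta>_mult_\<CC>: "c \<in> \<CC> \<Longrightarrow> \<Delta> * c \<in> \<O>"
  using algebraic_int_mult[OF _ algebraic_int_\<delta>, of "c * \<delta>"]
  by (auto simp: \<CC>_def \<O>_def \<delta>_mult_\<delta> mult_ac)

lemma O_module_\<BB>: "O_module \<BB>"
proof (rule O_moduleI)
  show "x + y \<in> \<BB>" if "x \<in> \<BB>" "y \<in> \<BB>" for x y
    using that integral_pair_add unfolding \<BB>_def by blast
  show "r * x \<in> \<BB>" if "r \<in> \<O>" "x \<in> \<BB>" for r x
    using that integral_pair_mult unfolding \<BB>_def by blast
  show "0 \<in> \<BB>" using integral_pair_0_left[of 0] unfolding \<BB>_def by (auto simp: \<CC>_def)
qed (auto simp: \<BB>_def integral_pair_def)

lemma O_module_\<CC>: "O_module \<CC>"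
proof (rule O_moduleI)
  show "x + y \<in> \<CC>" if "x \<in> \<CC>" "y \<in> \<CC>" for x y
    using that by (auto simp: \<CC>_def distrib_right)
  show "r * x \<in> \<CC>" if "r \<in> \<O>" "x \<in> \<CC>" for r x
    using that by (auto simp: \<CC>_def \<O>_def mult.assoc)
qed (auto simp: \<CC>_def)

lemma invertible_\<CC>: "invertible \<CC>"
  by (rule invertible_if_fractional[OF O_module_\<CC> one_in_\<CC> _ \<Delta>_in_K \<Delta>_nonzero \<Delta>_mult_\<CC>]) auto

lemma one_in_\<BB>: "1 \<in> \<BB>"
  using one_in_\<CC> \<CC>_subset_\<BB> by auto

lemma invertible_\<BB>: "invertible \<BB>"
proof (rule invertible_if_fractional[OF O_module_\<BB> one_in_\<BB>])
  show "2 * \<Delta> * y \<in> \<O>" if "y \<in> \<BB>" for y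
    using \<Delta>_mult_\<CC>[OF two_mult_\<BB>[OF that]] by (simp add: mult_ac)
qed (use \<Delta>_nonzero in auto)

section \<open>The largest square divisor, the largest modulus and their product\<close>

definition \<SS> :: "'a set" where "\<SS> = inverse_ideal K \<CC>"
definition \<FF> :: "'a set" where "\<FF> = inverse_ideal K \<BB>"
definition \<TT> :: "'a set" where "\<TT> = \<FF> \<odot> \<CC>"

lemma invertible_SFT: "invertible \<SS>" "invertible \<FF>" "invertible \<TT>"
  by (auto simp: \<SS>_def \<FF>_def \<TT>_def intro: invertible_inverse invertible_prod invertible_\<CC> invertible_\<BB>)

lemmas O_modules [simp, intro] =
  O_module_\<BB> O_module_\<CC> invertible_SFT[THEN invertible_imp_O_module]

lemma inverse_SFT:
  "inverse_ideal K \<SS> = \<CC>" "inverse_ideal K \<FF> = \<BB>" "inverse_ideal K \<TT> = \<BB> \<odot> \<SS>"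
  by (simp_all add: \<SS>_def \<FF>_def \<TT>_def invertible_inverse invertible_prod invertible_\<CC> invertible_\<BB>)

lemma \<SS>_mult_\<TT>: "\<SS> \<odot> \<TT> = \<FF>"
proof -
  have "\<SS> \<odot> \<TT> = (\<SS> \<odot> \<CC>) \<odot> \<FF>" by (simp add: \<TT>_def module_prod_ac)
  thus ?thesis
    using prod_inverse_ideal(2)[OF invertible_\<CC>] by (simp add: \<SS>_def[symmetric])
qed

lemma integral_SFT: "\<SS> \<subseteq> \<O>" "\<FF> \<subseteq> \<O>" "\<TT> \<subseteq> \<O>"
proof -
  show "\<SS> \<subseteq> \<O>" "\<FF> \<subseteq> \<O>"
    using inverse_idealD[OF _ one_in_\<CC>] inverse_idealD[OF _ one_in_\<BB>]
    by (auto simp: \<SS>_def \<FF>_def)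
  show "\<TT> \<subseteq> \<O>"
    unfolding \<TT>_def
    by (rule module_prod_subset_module[OF O_module_O])
       (use inverse_idealD \<CC>_subset_\<BB> in \<open>auto simp: \<FF>_def\<close>)
qed

text \<open>Every \<open>c ^ 2 * \<Delta>\<close> with \<open>c \<in> \<CC>\<close> is integral, so
  all of \<open>\<CC> \<odot> \<CC>\<close> lies in the inverse of the ideal of
  \<open>\<Delta>\<close>; inverses reverse the inclusion.\<close>

lemma \<Delta>_in_\<SS>_square: "\<Delta> \<in> \<SS> \<odot> \<SS>"
proof -
  have "\<CC> \<odot> \<CC> \<subseteq> inverse_ideal K (principal \<Delta>)"
  proof (rule squares_imp_module_prod_subset)
    fix c assume "c \<in> \<CC>"
    hence "c \<in> K" "c ^ 2 * \<Delta> \<in> \<O>" by (auto simp: mem_\<CC>_iff)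
    thus "c ^ 2 \<in> inverse_ideal K (principal \<Delta>)"
      by (auto simp: mem_inverse_ideal_iff principal_def mult.left_commute)
  qed (simp_all add: O_module_inverse O_module_principal)
  hence "principal \<Delta> \<subseteq> inverse_ideal K (\<CC> \<odot> \<CC>)"
    using inverse_ideal_antimono invertible_principal(1)[OF \<Delta>_in_K \<Delta>_nonzero] invertible_inverse(2)
    by metis
  hence "principal \<Delta> \<subseteq> \<SS> \<odot> \<SS>" by (simp add: \<SS>_def invertible_prod invertible_\<CC>)
  thus ?thesis using self_mem_principal by blast
qed

lemma inverse_square_mult:
  assumes "invertible M" "z \<in> M \<odot> M" "w \<in> inverse_ideal K M"
  shows "w ^ 2 * z \<in> \<O>"
proof -
  have "w ^ 2 \<in> inverse_ideal K (M \<odot> M)"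
    using module_prodI[OF assms(3,3)] invertible_prod(2)[OF assms(1,1)] by (simp add: power2_eq_square)
  thus ?thesis using assms(2) by (rule inverse_idealD)
qed

text \<open>Elements \<open>w\<close> of the inverse of \<open>M\<close> make
  \<open>w ^ 2 * \<Delta>\<close> integral and so belong to \<open>\<CC>\<close>. Least as a set
  means largest for divisibility.\<close>

lemma \<SS>_least:
  assumes M: "invertible M" and \<Delta>: "\<Delta> \<in> M \<odot> M"
  shows "\<SS> \<subseteq> M"
  unfolding \<SS>_def
proof (rule inverse_ideal_subset[OF M], rule subsetI)
  fix w assume "w \<in> inverse_ideal K M"
  thus "w \<in> \<CC>" using inverse_square_mult[OF M \<Delta>] by (auto simp: mem_\<CC>_iff mem_inverse_ideal_iff)
qed

text \<open>As \<open>2 * b \<in> \<CC>\<close> for \<open>b \<in> \<BB>\<close>, twice the inverse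
  of \<open>\<TT>\<close>, which is \<open>\<BB> \<odot> \<SS>\<close>, is integral.\<close>

lemma two_in_\<TT>: "2 \<in> \<TT>"
proof -
  have "\<BB> \<odot> \<SS> \<subseteq> inverse_ideal K (principal 2)"
  proof (rule module_prod_subset_module)
    fix b c assume "b \<in> \<BB>" "c \<in> \<SS>"
    hence "c * (2 * b) \<in> \<O>" using two_mult_\<BB> inverse_idealD unfolding \<SS>_def by blast
    moreover have "b \<in> K" "c \<in> K" using \<open>b \<in> \<BB>\<close> \<open>c \<in> \<SS>\<close> O_moduleD(2) by blast+
    ultimately show "b * c \<in> inverse_ideal K (principal 2)"
      by (auto simp: mem_inverse_ideal_iff principal_def)
         (metis O_closed(6) mult.assoc mult.commute)
  qed (simp_all add: O_module_inverse O_module_principal)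
  hence "inverse_ideal K \<TT> \<subseteq> inverse_ideal K (principal 2)" by (simp add: inverse_SFT)
  hence "principal 2 \<subseteq> \<TT>"
    using inverse_ideal_antimono invertible_principal(1)[of 2] invertible_inverse(2) invertible_SFT(3)
    by (metis K_numeral zero_neq_numeral)
  thus ?thesis using self_mem_principal by blast
qed

text \<open>\<open>\<BB>\<close> is projective, so that the module of integral pairs splits: with \<open>\<Sum> f\<^sub>i b\<^sub>i = 1\<close> for
  \<open>f\<^sub>i \<in> \<FF>\<close>, \<open>b\<^sub>i \<in> \<BB>\<close> and integral pairs \<open>(a\<^sub>i, b\<^sub>i)\<close>, the element \<open>x = \<Sum> f\<^sub>i a\<^sub>i\<close> makes
  \<open>(b x, b)\<close> an integral pair for every \<open>b \<in> \<BB>\<close>.\<close>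

lemma splitting:
  obtains x where "x \<in> \<O>" "\<And>b. b \<in> \<BB> \<Longrightarrow> integral_pair (b * x) b"
proof -
  obtain F p where F: "finite F" "F \<subseteq> \<BB>" "\<And>x. x \<in> F \<Longrightarrow> p x \<in> K"
    "\<And>x y. x \<in> F \<Longrightarrow> y \<in> \<BB> \<Longrightarrow> p x * y \<in> \<O>" "(\<Sum>x\<in>F. x * p x) = 1"
    using fractional_ideal_partition_of_unity[OF O_module_\<BB> one_in_\<BB>, of "2 * \<Delta>"]
      \<Delta>_mult_\<CC>[OF two_mult_\<BB>] \<Delta>_nonzero by (auto simp: mult_ac)
  have "\<forall>b\<in>F. \<exists>a. integral_pair a b" using F(2) by (auto simp: \<BB>_def)
  then obtain a where a: "\<And>b. b \<in> F \<Longrightarrow> integral_pair (a b) b" by metis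
  define x where "x = (\<Sum>c\<in>F. p c * a c)"
  have pair: "integral_pair (b * x) b" if b: "b \<in> \<BB>" for b
  proof -
    have "integral_pair (\<Sum>c\<in>F. (p c * b) * a c) (\<Sum>c\<in>F. (p c * b) * c)"
      using F(4) b a by (intro integral_pair_sum integral_pair_mult) auto
    moreover have "(\<Sum>c\<in>F. (p c * b) * a c) = b * x"
      unfolding x_def sum_distrib_left by (intro sum.cong) auto
    moreover have "(\<Sum>c\<in>F. (p c * b) * c) = b * (\<Sum>c\<in>F. c * p c)"
      unfolding sum_distrib_left by (intro sum.cong) auto
    ultimately show ?thesis using F(5) by simp
  qed
  have "algebraic_int (x + \<delta>)" "x \<in> K" using pair[OF one_in_\<BB>] by (simp_all add: integral_pair_def)
  hence "x \<in> \<O>" using algebraic_int_diff[of "x + \<delta>" \<delta>] by (simp add: \<O>_def)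
  thus ?thesis using pair that by blast
qed

text \<open>With \<open>x\<close> from \<open>splitting\<close>, the norm of the pair
  \<open>(b * x, b)\<close> is \<open>b ^ 2 * (x ^ 2 - \<Delta>)\<close>. It is integral for all
  \<open>b \<in> \<BB>\<close>, so \<open>\<Delta> - x ^ 2\<close> lies in the inverse of
  \<open>\<BB> \<odot> \<BB>\<close>.\<close>

lemma \<Delta>_square_mod_\<FF>: "\<exists>x\<in>\<O>. \<Delta> - x ^ 2 \<in> \<FF> \<odot> \<FF>"
proof -
  obtain x where x: "x \<in> \<O>" "\<And>b. b \<in> \<BB> \<Longrightarrow> integral_pair (b * x) b"
    using splitting by blast
  define z where "z = \<Delta> - x ^ 2"
  have z: "z \<in> K" using O_imp_K[OF x(1)] by (simp add: z_def)
  define N where "N = {y \<in> K. y * z \<in> \<O>}"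
  have "\<BB> \<odot> \<BB> \<subseteq> N"
  proof (rule squares_imp_module_prod_subset)
    show "O_module N" by (rule O_moduleI) (auto simp: N_def distrib_right mult.assoc)
    fix b assume b: "b \<in> \<BB>"
    have "- ((b * x) ^ 2 - b ^ 2 * \<Delta>) \<in> \<O>" 
      using x(2)[OF b] unfolding integral_pair_iff by (intro O_closed(3)) auto
    also have "- ((b * x) ^ 2 - b ^ 2 * \<Delta>) = b ^ 2 * z"
      by (simp add: z_def algebra_simps power_mult_distrib)
    finally show "b ^ 2 \<in> N" using b O_moduleD(2)[OF O_module_\<BB>] by (auto simp: N_def)
  qed simp
  hence "z \<in> inverse_ideal K (\<BB> \<odot> \<BB>)"
    using z by (auto simp: mem_inverse_ideal_iff N_def mult.commute)
  hence "z \<in> \<FF> \<odot> \<FF>" by (simp add: \<FF>_def invertible_prod invertible_\<BB>)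
  thus ?thesis using x(1) by (auto simp: z_def)
qed

text \<open>Since \<open>x ^ 2\<close> lies in the square of \<open>\<SS>\<close>, \<open>x\<close>
  lies in \<open>\<SS>\<close> and \<open>2 * x\<close> in \<open>N = \<SS> \<odot> M\<close>. For
  \<open>b\<close> in the inverse of \<open>N\<close>, the pair \<open>(b * x, b)\<close> then has
  integral trace and norm. Hence \<open>\<FF> \<subseteq> N\<close>, and multiplication by
  \<open>\<CC>\<close> cancels \<open>\<SS>\<close>.\<close>

lemma \<TT>_least:
  assumes M: "invertible M" "M \<subseteq> \<O>" "2 \<in> M" and x: "x \<in> \<O>" "\<Delta> - x ^ 2 \<in> (\<SS> \<odot> M) \<odot> (\<SS> \<odot> M)"
  shows "\<TT> \<subseteq> M"
proof -
  define N where "N = \<SS> \<odot> M"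
  have N: "invertible N" unfolding N_def using M invertible_SFT by (intro invertible_prod)
  have "N \<subseteq> \<SS>"
    unfolding N_def using module_prod_integral[OF M(2), of \<SS>] by (simp add: module_prod_commute)
  hence "\<Delta> - x ^ 2 \<in> \<SS> \<odot> \<SS>" using module_prod_mono x(2) N_def by blast
  hence "\<Delta> + (- 1) * (\<Delta> - x ^ 2) \<in> \<SS> \<odot> \<SS>"
    using \<Delta>_in_\<SS>_square by (intro O_moduleD(4,5) O_module_prod) auto
  hence "x \<in> \<SS>"
    using mem_if_square_mem[OF invertible_SFT(1), of x] x(1) by auto
  hence "2 * x \<in> N" unfolding N_def using module_prodI[of x \<SS> 2 M] M(3) by (simp add: mult.commute)
  have "inverse_ideal K N \<subseteq> \<BB>"
  proof
    fix b assume b: "b \<in> inverse_ideal K N"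
    hence bK: "b \<in> K" by (simp add: mem_inverse_ideal_iff)
    have "- (b ^ 2 * (\<Delta> - x ^ 2)) \<in> \<O>"
      using inverse_square_mult[OF N _ b] x(2) by (intro O_closed(3)) (simp add: N_def)
    hence "(b * x) ^ 2 - b ^ 2 * \<Delta> \<in> \<O>" by (simp add: algebra_simps power_mult_distrib)
    moreover have "2 * (b * x) \<in> \<O>"
      using inverse_idealD[OF b \<open>2 * x \<in> N\<close>] by (simp add: mult_ac)
    ultimately have "integral_pair (b * x) b" using bK x(1) by (auto simp: integral_pair_iff)
    thus "b \<in> \<BB>" by (auto simp: \<BB>_def)
  qed
  hence "\<FF> \<subseteq> N" unfolding \<FF>_def by (rule inverse_ideal_subset[OF N])
  hence "\<TT> \<subseteq> N \<odot> \<CC>" unfolding \<TT>_def by (intro module_prod_mono) auto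
  also have "N \<odot> \<CC> = (\<SS> \<odot> \<CC>) \<odot> M" by (simp add: N_def module_prod_ac)
  also have "\<dots> = M"
    using prod_inverse_ideal(2)[OF invertible_\<CC>] invertible_imp_O_module[OF M(1)]
    by (simp add: \<SS>_def)
  finally show ?thesis .
qed

section \<open>Half of \<open>\<FF>\<close>, the conductor of a discriminant\<close>

definition \<GG> :: "'a set" where "\<GG> = principal (1 / 2) \<odot> \<FF>"

lemma invertible_\<GG>: "invertible \<GG>"
  unfolding \<GG>_def by (intro invertible_prod invertible_principal invertible_SFT) auto

lemma mem_\<GG>_iff: "x \<in> \<GG> \<longleftrightarrow> 2 * x \<in> \<FF>"
  unfolding \<GG>_def by (subst mem_principal_prod_iff) (auto simp: mult.commute)

lemma \<GG>_square: "principal 4 \<odot> (\<GG> \<odot> \<GG>) = \<FF> \<odot> \<FF>"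
proof -
  have "principal 4 \<odot> (\<GG> \<odot> \<GG>) = (principal 4 \<odot> (principal (1/2) \<odot> principal (1/2))) \<odot> (\<FF> \<odot> \<FF>)"
    by (simp add: \<GG>_def module_prod_ac)
  also have "principal 4 \<odot> (principal (1/2) \<odot> principal (1/2)) = \<O>"
    by (simp add: principal_mult principal_1)
  finally show ?thesis by (simp add: O_module_prod)
qed

lemma inverse_\<GG>_square:
  "inverse_ideal K (\<GG> \<odot> \<GG>) = principal 4 \<odot> (\<BB> \<odot> \<BB>)"
proof -
  have "inverse_ideal K \<GG> = principal 2 \<odot> \<BB>"
    by (simp add: \<GG>_def invertible_prod invertible_principal invertible_SFT inverse_SFT)
  hence "inverse_ideal K (\<GG> \<odot> \<GG>) = (principal 2 \<odot> principal 2) \<odot> (\<BB> \<odot> \<BB>)"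
    using invertible_\<GG> by (simp add: invertible_prod module_prod_ac)
  thus ?thesis by (simp add: principal_mult)
qed

text \<open>The congruence modulo 4 makes \<open>(x + \<delta>) / 2\<close> integral. So
  \<open>1 / 2 \<in> \<BB>\<close>, and every element of \<open>\<FF>\<close> is divisible by
  2.\<close>

lemma \<GG>_integral:
  assumes "x \<in> \<O>" "\<Delta> - x ^ 2 \<in> principal 4"
  shows "\<GG> \<subseteq> \<O>"
proof -
  have "- ((\<Delta> - x ^ 2) / 4) \<in> \<O>" using assms(2) by (intro O_closed(3)) (simp add: mem_principal_iff)
  hence "(x / 2) ^ 2 - (1 / 2) ^ 2 * \<Delta> \<in> \<O>" by (simp add: power2_eq_square diff_divide_distrib)
  hence "integral_pair (x / 2) (1 / 2)" using assms(1) by (auto simp: integral_pair_iff)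
  hence "1 / 2 \<in> \<BB>" by (auto simp: \<BB>_def)
  hence "(2 * x) * (1 / 2) \<in> \<O>" if "x \<in> \<GG>" for x
    using that inverse_idealD[of "2 * x" \<BB> "1 / 2"] by (simp add: mem_\<GG>_iff \<FF>_def)
  thus ?thesis by auto
qed

text \<open>From \<open>2 * b \<in> \<CC>\<close> for \<open>b \<in> \<BB>\<close>, all
  \<open>4 * \<Delta> * b ^ 2\<close> are integral; hence \<open>4 * \<Delta>\<close> lies in
  \<open>\<FF> \<odot> \<FF>\<close>.\<close>

lemma \<Delta>_in_\<GG>_square: "\<Delta> \<in> \<GG> \<odot> \<GG>"
proof -
  have "\<BB> \<odot> \<BB> \<subseteq> inverse_ideal K (principal (4 * \<Delta>))"
  proof (rule squares_imp_module_prod_subset)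
    fix b assume b: "b \<in> \<BB>"
    have "(2 * b) ^ 2 * \<Delta> \<in> \<O>" using two_mult_\<BB>[OF b] by (simp add: mem_\<CC>_iff)
    hence "r * ((2 * b) ^ 2 * \<Delta>) \<in> \<O>" if "r \<in> \<O>" for r using that by (rule_tac O_closed)
    moreover have "b ^ 2 * (r * (4 * \<Delta>)) = r * ((2 * b) ^ 2 * \<Delta>)" for r
      by (simp add: power_mult_distrib)
    ultimately have "b ^ 2 * (r * (4 * \<Delta>)) \<in> \<O>" if "r \<in> \<O>" for r
      using that by (simp only:)
    hence "b ^ 2 * y \<in> \<O>" if "y \<in> principal (4 * \<Delta>)" for y
      using that unfolding principal_def by blast
    thus "b ^ 2 \<in> inverse_ideal K (principal (4 * \<Delta>))"
      using O_moduleD(2)[OF O_module_\<BB> b] by (simp add: mem_inverse_ideal_iff)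
  qed (simp_all add: O_module_inverse O_module_principal)
  hence "principal (4 * \<Delta>) \<subseteq> inverse_ideal K (\<BB> \<odot> \<BB>)"
    using inverse_ideal_antimono invertible_principal(1)[of "4 * \<Delta>"] invertible_inverse(2) \<Delta>_nonzero
    by (metis K_closed(5) K_numeral \<Delta>_in_K mult_eq_0_iff zero_neq_numeral)
  hence "4 * \<Delta> \<in> \<FF> \<odot> \<FF>"
    using self_mem_principal by (auto simp: \<FF>_def invertible_prod invertible_\<BB>)
  thus ?thesis
    using mem_principal_prod_iff[OF O_module_prod, of \<GG> \<GG> 4 "4 * \<Delta>"] invertible_\<GG>
    by (simp add: \<GG>_square invertible_imp_O_module)
qed

text \<open>Both hypotheses put \<open>x ^ 2\<close> into \<open>M \<odot> M\<close>, so
  \<open>x \<in> M\<close>. For \<open>w\<close> in the inverse of \<open>M\<close>, the pair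
  \<open>(w * x / 2, w / 2)\<close> has trace \<open>w * x\<close> and norm
  \<open>- (w ^ 2 * z)\<close>, both integral, whence \<open>w / 2 \<in> \<BB>\<close>.\<close>

lemma \<GG>_least:
  assumes M: "invertible M" "\<Delta> \<in> M \<odot> M" and x: "x \<in> \<O>" "\<Delta> - x ^ 2 \<in> principal 4 \<odot> (M \<odot> M)"
  shows "\<GG> \<subseteq> M"
proof
  have MM: "O_module (M \<odot> M)" using M by (intro O_module_prod invertible_imp_O_module)
  define z where "z = (\<Delta> - x ^ 2) / 4"
  have z: "z \<in> M \<odot> M" using x(2) MM by (simp add: z_def mem_principal_prod_iff)
  have "\<Delta> + (- 4) * z \<in> M \<odot> M"
    using M z O_closed(3)[OF O_numeral] by (intro O_moduleD(4,5)[OF MM]) auto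
  moreover have "\<Delta> + (- 4) * z = x ^ 2" by (simp add: z_def diff_divide_distrib)
  ultimately have "x \<in> M"
    using mem_if_square_mem[OF M(1), of x] x(1) by auto
  fix g assume g: "g \<in> \<GG>"
  have "g * w \<in> \<O>" if w: "w \<in> inverse_ideal K M" for w
  proof -
    have wK: "w \<in> K" using w by (simp add: mem_inverse_ideal_iff)
    have "w * x \<in> \<O>" using inverse_idealD[OF w \<open>x \<in> M\<close>] .
    moreover have "- (w ^ 2 * z) \<in> \<O>" using inverse_square_mult[OF M(1) z w] by (rule O_closed)
    hence "(w * x / 2) ^ 2 - (w / 2) ^ 2 * \<Delta> \<in> \<O>"
      by (simp add: z_def power2_eq_square algebra_simps diff_divide_distrib)
    ultimately have "integral_pair (w * x / 2) (w / 2)"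
      using wK x(1) by (auto simp: integral_pair_iff)
    hence "w / 2 \<in> \<BB>" by (auto simp: \<BB>_def)
    thus ?thesis using g inverse_idealD[of "2 * g" \<BB> "w / 2"] by (simp add: mem_\<GG>_iff \<FF>_def)
  qed
  moreover have "g \<in> K" using g invertible_imp_O_module[OF invertible_\<GG>] O_moduleD(2) by blast
  ultimately have "g \<in> inverse_ideal K (inverse_ideal K M)" by (simp add: mem_inverse_ideal_iff)
  thus "g \<in> M" using invertible_inverse(2)[OF M(1)] by simp
qed

end

section \<open>Integral ideals\<close>

context number_field_carrier
begin

lemma ring_of_integers_simps [simp]:
  "x \<otimes>\<^bsub>ring_of_integers K\<^esub> y = x * y" "x \<oplus>\<^bsub>ring_of_integers K\<^esub> y = x + y"
  "\<zero>\<^bsub>ring_of_integers K\<^esub> = 0" "\<one>\<^bsub>ring_of_integers K\<^esub> = 1"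
  "carrier (ring_of_integers K) = \<O>"
  using carrier_ring_of_integers
  by (simp_all add: ring_of_integers_def ring_of_type_algebra_def)

lemma ring_ring_of_integers: "ring (ring_of_integers K)"
proof -
  have "subring \<O> ambient" by (rule ambient.subringI) auto
  moreover have "ring_of_integers K = ambient\<lparr>carrier := \<O>\<rparr>"
    by (simp add: ring_of_integers_def \<O>_def)
  ultimately show ?thesis
    using ambient.subring_is_ring by metis
qed

lemma ring_of_integers_a_inv:
  assumes "x \<in> \<O>"
  shows "\<ominus>\<^bsub>ring_of_integers K\<^esub> x = - x"
proof -
  interpret R: ring "ring_of_integers K" by (rule ring_ring_of_integers)
  show ?thesis by (rule R.minus_equality) (use assms in auto)
qed

lemma ideal_iff: "ideal I (ring_of_integers K) \<longleftrightarrow> O_module I \<and> I \<subseteq> \<O>"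
proof (intro iffI conjI)
  assume I: "ideal I (ring_of_integers K)"
  note add = ideal.axioms(1)[OF I]
  show sub: "I \<subseteq> \<O>" using additive_subgroup.a_subset[OF add] by simp
  show "O_module I"
    using sub additive_subgroup.a_closed[OF add] additive_subgroup.zero_closed[OF add]
      ideal.I_l_closed[OF I] by (intro O_moduleI) auto
next
  assume I: "O_module I \<and> I \<subseteq> \<O>"
  interpret R: ring "ring_of_integers K" by (rule ring_ring_of_integers)
  show "ideal I (ring_of_integers K)"
  proof (rule idealI[OF ring_ring_of_integers])
    show "subgroup I (add_monoid (ring_of_integers K))"
    proof (rule R.add.subgroupI)
      show "\<ominus>\<^bsub>ring_of_integers K\<^esub> x \<in> I" if "x \<in> I" for x
        using O_moduleD(5)[of I "- 1" x] I that ring_of_integers_a_inv[of x] by auto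
    qed (use I O_moduleD(3,4)[of I] in auto)
    show "x \<otimes>\<^bsub>ring_of_integers K\<^esub> a \<in> I" "a \<otimes>\<^bsub>ring_of_integers K\<^esub> x \<in> I"
      if "a \<in> I" "x \<in> carrier (ring_of_integers K)" for a x
      using O_moduleD(5)[of I x a] I that by (simp_all add: mult.commute)
  qed
qed

lemma carrier_integral_ideals: "carrier (integral_ideals K) = {I. O_module I \<and> I \<subseteq> \<O>}"
  by (simp add: ideals_set_def ideal_iff)

text \<open>Finite sums of products are the same in the ring of integers and in the ambient
  field.\<close>

lemma integral_ideals_mult: "I \<otimes>\<^bsub>integral_ideals K\<^esub> J = I \<odot> J"
proof -
  have "x \<in> I \<odot> J" if "x \<in> ideal_prod (ring_of_integers K) I J" for x
    using that by induction (auto intro: module_prodI module_prod_add)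
  moreover have "x \<in> ideal_prod (ring_of_integers K) I J" if "x \<in> I \<odot> J" for x
    using that ideal_prod.intros[where R = "ring_of_integers K" and I = I and J = J]
    by induction auto
  ultimately show ?thesis by (auto simp: ideals_set_def)
qed

lemma integral_ideals_square:
  assumes "O_module I"
  shows "I [^]\<^bsub>integral_ideals K\<^esub> (2::nat) = I \<odot> I"
proof -
  have "\<one>\<^bsub>integral_ideals K\<^esub> = \<O>" by (simp add: ideals_set_def)
  thus ?thesis
    using assms by (simp add: nat_pow_def numeral_2_eq_2 integral_ideals_mult)
qed

lemma principal_ideal_eq: "principal_ideal K a = principal a"
  by (simp add: cgenideal_def principal_def)

lemma divides_iff:
  "I divides\<^bsub>integral_ideals K\<^esub> J \<longleftrightarrow> (\<exists>C. O_module C \<and> C \<subseteq> \<O> \<and> J = I \<odot> C)"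
  by (auto simp: factor_def carrier_integral_ideals integral_ideals_mult)

lemma divides_imp_subset:
  assumes "O_module I" "I divides\<^bsub>integral_ideals K\<^esub> J"
  shows "J \<subseteq> I"
  using assms module_prod_integral by (auto simp: divides_iff module_prod_commute[of I])

text \<open>To contain is to divide: the cofactor is the inverse of \<open>I\<close> times
  \<open>J\<close>.\<close>

lemma divides_if_subset:
  assumes I: "invertible I" and J: "O_module J" "J \<subseteq> I"
  shows "I divides\<^bsub>integral_ideals K\<^esub> J"
  unfolding divides_iff
proof (intro exI conjI)
  show "O_module (inverse_ideal K I \<odot> J)"
    using J invertible_imp_O_module[OF I] by (intro O_module_prod O_module_inverse)
  show "inverse_ideal K I \<odot> J \<subseteq> \<O>"
    using module_prod_mono[OF subset_refl J(2), of "inverse_ideal K I"] prod_inverse_ideal(2)[OF I] by simp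
  show "J = I \<odot> (inverse_ideal K I \<odot> J)"
    using J by (simp add: module_prod_assoc[symmetric] prod_inverse_ideal[OF I])
qed

text \<open>The cofactor divided by \<open>a\<close> is an inverse. Candidates for a largest ideal
  may a priori be zero; this shows that they are invertible.\<close>

lemma divides_principal_imp_invertible:
  assumes I: "O_module I" and a: "a \<in> K" "a \<noteq> 0" and dvd: "I divides\<^bsub>integral_ideals K\<^esub> principal a"
  shows "invertible I"
proof -
  obtain C where C: "O_module C" "principal a = I \<odot> C" using dvd by (auto simp: divides_iff)
  have "I \<odot> (C \<odot> principal (inverse a)) = principal a \<odot> principal (inverse a)"
    using C by (simp add: module_prod_assoc)
  also have "\<dots> = \<O>" using a by (simp add: principal_mult principal_1)
  finally show ?thesis
    using I C(1) a by (intro inverse_ideal_unique(1)) (auto intro: O_module_prod O_module_principal)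
qed

text \<open>\<open>I\<close> times the inverse of its square is an inverse of
  \<open>I\<close>.\<close>

lemma square_divides_principal_imp_invertible:
  assumes I: "O_module I" and a: "a \<in> K" "a \<noteq> 0" and dvd: "I \<odot> I divides\<^bsub>integral_ideals K\<^esub> principal a"
  shows "invertible I"
proof -
  have inv: "invertible (I \<odot> I)"
    using divides_principal_imp_invertible[OF O_module_prod[OF I I] a dvd] .
  have "I \<odot> (I \<odot> inverse_ideal K (I \<odot> I)) = \<O>"
    using prod_inverse_ideal(1)[OF inv] by (simp add: module_prod_assoc)
  thus ?thesis
    using I inv by (intro inverse_ideal_unique(1)) (auto intro: O_module_prod O_module_inverse)
qed

lemma divides_principal_iff:
  assumes I: "invertible I" and a: "a \<in> K"
  shows "I divides\<^bsub>integral_ideals K\<^esub> principal a \<longleftrightarrow> a \<in> I"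
  using divides_imp_subset[of I "principal a"] divides_if_subset[OF I O_module_principal[OF a]]
    principal_subset_iff[of I a] invertible_imp_O_module[OF I] by auto

text \<open>Two largest ideals divide and so contain each other, which gives the uniqueness for the
  definite description.\<close>

lemma largest_ideal_eqI:
  assumes I: "O_module I" "I \<subseteq> \<O>" "P I"
    and greatest: "\<And>J. O_module J \<Longrightarrow> J \<subseteq> \<O> \<Longrightarrow> P J \<Longrightarrow> J divides\<^bsub>integral_ideals K\<^esub> I"
  shows "largest_ideal K P = I"
  unfolding largest_ideal_def
proof (rule the_equality)
  fix J assume J: "J \<in> carrier (integral_ideals K) \<and> P J \<and>
    (\<forall>I\<in>carrier (integral_ideals K). P I \<longrightarrow> I divides\<^bsub>integral_ideals K\<^esub> J)"
  hence "I divides\<^bsub>integral_ideals K\<^esub> J" "J divides\<^bsub>integral_ideals K\<^esub> I"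
    using I greatest by (auto simp: carrier_integral_ideals)
  thus "J = I"
    using divides_imp_subset[of I J] divides_imp_subset[of J I] I J
    by (simp add: carrier_integral_ideals)
qed (use I greatest in \<open>auto simp: carrier_integral_ideals\<close>)

lemma ideal_quotient_eq: "ideal_quotient K I J = I \<odot> inverse_ideal K J"
  by (simp add: ideal_quotient_def)

end

context quadratic_extension
begin

section \<open>Identification of the three largest ideals\<close>

lemma largest_square_divisor:
  "largest_ideal K (\<lambda>\<aa>. \<aa> [^]\<^bsub>integral_ideals K\<^esub> (2::nat) divides\<^bsub>integral_ideals K\<^esub> principal_ideal K \<Delta>) = \<SS>"
proof (rule largest_ideal_eqI)
  show "\<SS> [^]\<^bsub>integral_ideals K\<^esub> (2::nat) divides\<^bsub>integral_ideals K\<^esub> principal_ideal K \<Delta>"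
    using \<Delta>_in_\<SS>_square
    by (simp add: integral_ideals_square principal_ideal_eq divides_principal_iff invertible_prod invertible_SFT)
  fix J assume J: "O_module J" "J \<subseteq> \<O>"
    "J [^]\<^bsub>integral_ideals K\<^esub> (2::nat) divides\<^bsub>integral_ideals K\<^esub> principal_ideal K \<Delta>"
  hence dvd: "J \<odot> J divides\<^bsub>integral_ideals K\<^esub> principal \<Delta>"
    by (simp add: integral_ideals_square principal_ideal_eq)
  hence inv: "invertible J"
    using square_divides_principal_imp_invertible[OF J(1) \<Delta>_in_K \<Delta>_nonzero] by simp
  moreover have "\<Delta> \<in> J \<odot> J" using dvd inv by (simp add: divides_principal_iff invertible_prod)
  ultimately show "J divides\<^bsub>integral_ideals K\<^esub> \<SS>"
    by (intro divides_if_subset \<SS>_least) auto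
qed (simp_all add: integral_SFT)

lemma square_modulo_iff: "square_modulo K \<Delta> M \<longleftrightarrow> (\<exists>x\<in>\<O>. \<Delta> - x ^ 2 \<in> M)"
  by (simp add: square_modulo_def)

lemma largest_square_modulus:
  "largest_ideal K (\<lambda>\<bb>. \<bb> divides\<^bsub>integral_ideals K\<^esub> principal_ideal K 2 \<and>
     square_modulo K \<Delta> ((\<SS> \<otimes>\<^bsub>integral_ideals K\<^esub> \<bb>) [^]\<^bsub>integral_ideals K\<^esub> (2::nat))) = \<TT>"
proof (rule largest_ideal_eqI)
  show "\<TT> divides\<^bsub>integral_ideals K\<^esub> principal_ideal K 2 \<and>
     square_modulo K \<Delta> ((\<SS> \<otimes>\<^bsub>integral_ideals K\<^esub> \<TT>) [^]\<^bsub>integral_ideals K\<^esub> (2::nat))"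
    using two_in_\<TT> \<Delta>_square_mod_\<FF>
    by (simp add: integral_ideals_mult \<SS>_mult_\<TT> integral_ideals_square principal_ideal_eq
        divides_principal_iff invertible_SFT square_modulo_iff)
  fix J assume J: "O_module J" "J \<subseteq> \<O>"
    "J divides\<^bsub>integral_ideals K\<^esub> principal_ideal K 2 \<and>
     square_modulo K \<Delta> ((\<SS> \<otimes>\<^bsub>integral_ideals K\<^esub> J) [^]\<^bsub>integral_ideals K\<^esub> (2::nat))"
  hence inv: "invertible J"
    using divides_principal_imp_invertible[OF J(1), of 2] by (simp add: principal_ideal_eq)
  moreover have "2 \<in> J" using J inv by (simp add: principal_ideal_eq divides_principal_iff)
  moreover obtain x where "x \<in> \<O>" "\<Delta> - x ^ 2 \<in> (\<SS> \<odot> J) \<odot> (\<SS> \<odot> J)"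
    using J by (auto simp: square_modulo_iff integral_ideals_mult integral_ideals_square O_module_prod)
  ultimately show "J divides\<^bsub>integral_ideals K\<^esub> \<TT>"
    using J(2) \<TT>_least by (intro divides_if_subset) auto
qed (simp_all add: integral_SFT)

lemma conductor_ideal_eq:
  assumes "is_discriminant K \<Delta>"
  shows "conductor_ideal K \<Delta> = \<GG>"
  unfolding conductor_ideal_def
proof (rule largest_ideal_eqI)
  have G: "O_module \<GG>" using invertible_\<GG> by (rule invertible_imp_O_module)
  thus "O_module \<GG>" .
  show "\<GG> \<subseteq> \<O>"
    using assms \<GG>_integral by (auto simp: is_discriminant_def square_modulo_iff principal_ideal_eq)
  show "\<GG> [^]\<^bsub>integral_ideals K\<^esub> (2::nat) divides\<^bsub>integral_ideals K\<^esub> principal_ideal K \<Delta> \<and>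
    square_modulo K \<Delta>
      (principal_ideal K 4 \<otimes>\<^bsub>integral_ideals K\<^esub> \<GG> [^]\<^bsub>integral_ideals K\<^esub> (2::nat))"
    using \<Delta>_in_\<GG>_square \<Delta>_square_mod_\<FF> G invertible_\<GG>
    by (simp add: integral_ideals_mult \<GG>_square integral_ideals_square principal_ideal_eq
        divides_principal_iff invertible_prod square_modulo_iff)
  fix J assume J: "O_module J" "J \<subseteq> \<O>"
    "J [^]\<^bsub>integral_ideals K\<^esub> (2::nat) divides\<^bsub>integral_ideals K\<^esub> principal_ideal K \<Delta> \<and>
    square_modulo K \<Delta>
      (principal_ideal K 4 \<otimes>\<^bsub>integral_ideals K\<^esub> J [^]\<^bsub>integral_ideals K\<^esub> (2::nat))"
  hence dvd: "J \<odot> J divides\<^bsub>integral_ideals K\<^esub> principal \<Delta>"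
    by (simp add: integral_ideals_square principal_ideal_eq)
  hence inv: "invertible J"
    using square_divides_principal_imp_invertible[OF J(1) \<Delta>_in_K \<Delta>_nonzero] by simp
  moreover have "\<Delta> \<in> J \<odot> J" using dvd inv by (simp add: divides_principal_iff invertible_prod)
  moreover obtain x where "x \<in> \<O>" "\<Delta> - x ^ 2 \<in> principal 4 \<odot> (J \<odot> J)"
    using J by (auto simp: square_modulo_iff integral_ideals_mult integral_ideals_square principal_ideal_eq)
  ultimately show "J divides\<^bsub>integral_ideals K\<^esub> \<GG>"
    using \<GG>_least G by (intro divides_if_subset) auto
qed

lemma ideal_quotient_\<FF>:
  "ideal_quotient K (principal_ideal K (4 * \<Delta>)) (\<FF> \<odot> \<FF>) = principal (4 * \<Delta>) \<odot> (\<BB> \<odot> \<BB>)"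
  by (simp add: ideal_quotient_eq principal_ideal_eq invertible_prod invertible_SFT inverse_SFT)

lemma ideal_quotient_\<GG>:
  "ideal_quotient K (principal_ideal K \<Delta>) (\<GG> \<odot> \<GG>) = principal (4 * \<Delta>) \<odot> (\<BB> \<odot> \<BB>)"
proof -
  have "principal \<Delta> \<odot> (principal 4 \<odot> (\<BB> \<odot> \<BB>)) = principal (4 * \<Delta>) \<odot> (\<BB> \<odot> \<BB>)"
    by (simp add: module_prod_assoc[symmetric] principal_mult mult.commute)
  thus ?thesis by (simp add: ideal_quotient_eq principal_ideal_eq inverse_\<GG>_square)
qed

end

section \<open>The relative discriminant\<close>

lemma det_2_mat:
  fixes f :: "nat \<times> nat \<Rightarrow> 'a::comm_ring_1"
  shows "det (mat 2 2 f) = f (0, 0) * f (1, 1) - f (1, 0) * f (0, 1)"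
proof -
  have "det (mat_delete (mat 2 2 f) 0 0) = f (1, 1)" "det (mat_delete (mat 2 2 f) 1 0) = f (0, 1)"
    by (subst det_single; simp add: mat_delete_def)+
  thus ?thesis
    by (subst laplace_expansion_column[of _ 2 0]) (simp_all add: cofactor_def numeral_2_eq_2)
qed

context number_field_carrier
begin

section \<open>Spans, and the discriminant of \<open>K\<close> over itself\<close>

lemma Span_singleton: "ambient.Span K [x] = {k * x | k. k \<in> K}"
  by (auto simp: ambient.line_extension_mem_iff)

lemma Span_pair: "ambient.Span K [x, y] = {k * x + l * y | k l. k \<in> K \<and> l \<in> K}"
proof -
  have "ambient.Span K [x, y] = ambient.line_extension K x (ambient.Span K [y])" by simp
  also have "\<dots> = {u. \<exists>k\<in>K. \<exists>v\<in>{l * y | l. l \<in> K}. u = k * x + v}"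
    unfolding Span_singleton
    by (rule Set.set_eqI) (simp only: ambient.line_extension_mem_iff ambient_simps mem_Collect_eq)
  also have "\<dots> = {k * x + l * y | k l. k \<in> K \<and> l \<in> K}" by blast
  finally show ?thesis .
qed

lemma generate_field_of_mem:
  assumes "\<delta> \<in> K"
  shows "generate_field ambient (insert \<delta> K) = K"
proof -
  have "insert \<delta> K = K" using assms by auto
  moreover have "K = generate_field ambient K"
    by (rule field.generate_fieldI[OF field_ambient _ subfield_K]) auto
  ultimately show ?thesis by simp
qed

lemma field_basis_self_iff: "field_basis K K b \<longleftrightarrow> (\<exists>x\<in>K. x \<noteq> 0 \<and> b = [x])"
proof
  assume b: "field_basis K K b"
  hence "ambient.dimension (length b) K K"
    unfolding field_basis_def by (blast intro: ambient.dimensionI[OF subfield_K])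
  hence "length b = 1"
    using ambient.dimension_is_inj[OF subfield_K _ ambient.dimension_one[OF subfield_K]] by blast
  then obtain x where x: "b = [x]" by (auto simp: length_Suc_conv)
  have "x \<noteq> 0"
    using ambient.independent_backwards(1)[of K x "[]"] b x by (auto simp: field_basis_def)
  moreover have "1 * x \<in> ambient.Span K [x]" unfolding Span_singleton by blast
  hence "x \<in> K" using b x by (simp add: field_basis_def)
  ultimately show "\<exists>x\<in>K. x \<noteq> 0 \<and> b = [x]" using x by blast
next
  assume "\<exists>x\<in>K. x \<noteq> 0 \<and> b = [x]"
  then obtain x where x: "x \<in> K" "x \<noteq> 0" "b = [x]" by blast
  have "ambient.independent K [x]" using x by (intro ambient.independent.intros) auto
  moreover have "ambient.Span K [x] = K"
    unfolding Span_singleton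
  proof (intro equalityI subsetI)
    fix y assume "y \<in> K"
    hence "y = (y / x) * x" "y / x \<in> K" using x by auto
    thus "y \<in> {k * x | k. k \<in> K}" by blast
  qed (use x in auto)
  ultimately show "field_basis K K b" by (simp add: field_basis_def x)
qed

lemma rel_trace_self:
  assumes "y \<in> K"
  shows "rel_trace K K y = y"
  unfolding rel_trace_def
proof (rule the_equality)
  have "field_basis K K [1]" by (auto simp: field_basis_self_iff)
  moreover have "mult_matrix K [1] y (mat 1 1 (\<lambda>_. y))"
    using assms by (auto simp: mult_matrix_def elements_mat_def)
  ultimately show "\<exists>b A. field_basis K K b \<and> mult_matrix K b y A \<and> y = (\<Sum>i<length b. A $$ (i, i))"
    by (intro exI[of _ "[1]"] exI[of _ "mat 1 1 (\<lambda>_. y)"]) auto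
  show "t = y" if "\<exists>b A. field_basis K K b \<and> mult_matrix K b y A \<and> t = (\<Sum>i<length b. A $$ (i, i))" for t
    using that by (auto simp: field_basis_self_iff mult_matrix_def)
qed

lemma basis_discriminant_self:
  assumes "x \<in> K"
  shows "basis_discriminant K K [x] = x ^ 2"
proof -
  have "det (mat 1 1 (\<lambda>(i, j). rel_trace K K ([x] ! i * [x] ! j))) = x ^ 2"
    using assms by (subst det_single) (auto simp: rel_trace_self power2_eq_square)
  thus ?thesis by (simp add: basis_discriminant_def)
qed

text \<open>The basis \<open>[1]\<close> has discriminant 1.\<close>

lemma relative_discriminant_self: "relative_discriminant K K = \<O>"
proof -
  let ?D = "{basis_discriminant K K b | b. field_basis K K b \<and> set b \<subseteq> carrier (ring_of_integers K)}"
  have "basis_discriminant K K [1] \<in> ?D" by (force simp: field_basis_self_iff)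
  hence "1 \<in> ?D" using basis_discriminant_self[of 1] by simp
  hence "\<O> \<subseteq> I" if "ideal I (ring_of_integers K)" "?D \<subseteq> I" for I
    using that O_moduleD(5)[of I _ 1] by (auto simp: ideal_iff)
  moreover have "?D \<subseteq> \<O>"
    by (auto simp: field_basis_self_iff basis_discriminant_self)
  moreover have "ideal \<O> (ring_of_integers K)" by (simp add: ideal_iff O_module_O)
  ultimately show ?thesis
    unfolding relative_discriminant_def genideal_def by blast
qed

end

context quadratic_extension
begin

text \<open>In this case \<open>\<BB>\<close> is principal, generated by
  \<open>1 / (2 * \<delta>)\<close>, and its square cancels \<open>4 * \<Delta>\<close>.\<close>

lemma discriminant_trivial_extension:
  assumes "\<delta> \<in> K"
  shows "principal (4 * \<Delta>) \<odot> (\<BB> \<odot> \<BB>) = \<O>"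
proof -
  have \<delta>: "\<delta> \<noteq> 0" using \<Delta>_nonzero \<delta>_square by auto
  have "b \<in> \<BB> \<longleftrightarrow> b \<in> principal (1 / (2 * \<delta>))" for b
  proof -
    have "b \<in> \<BB> \<longleftrightarrow> 2 * b * \<delta> \<in> \<O>"
    proof
      assume "b \<in> \<BB>"
      hence "algebraic_int (2 * b * \<delta>)" "b \<in> K" using two_mult_\<BB> by (auto simp: \<CC>_def \<BB>_def integral_pair_def)
      thus "2 * b * \<delta> \<in> \<O>" using assms by (simp add: \<O>_def)
    next
      assume *: "2 * b * \<delta> \<in> \<O>"
      hence "2 * b * \<delta> / (2 * \<delta>) \<in> K" using assms by (intro K_divide) auto
      hence "b \<in> K" using \<delta> by simp
      \<comment> \<open>With \<open>a = b * \<delta>\<close> one of the two elements is 0 and the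
        other is \<open>2 * b * \<delta>\<close>.\<close>
      hence "integral_pair (b * \<delta>) b"
        using * assms by (simp add: integral_pair_def \<O>_def algebra_simps)
      thus "b \<in> \<BB>" by (auto simp: \<BB>_def)
    qed
    also have "\<dots> \<longleftrightarrow> b \<in> principal (1 / (2 * \<delta>))"
      using \<delta> by (simp add: mem_principal_iff mult_ac)
    finally show ?thesis .
  qed
  hence "\<BB> = principal (1 / (2 * \<delta>))" by blast
  hence "principal (4 * \<Delta>) \<odot> (\<BB> \<odot> \<BB>) = principal (4 * \<Delta> * (1 / (2 * \<delta>) * (1 / (2 * \<delta>))))"
    using assms by (simp add: principal_mult)
  also have "4 * \<Delta> * (1 / (2 * \<delta>) * (1 / (2 * \<delta>))) = 1"
    using \<delta> by (simp add: \<delta>_square[symmetric] power2_eq_square)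
  finally show ?thesis by (simp add: principal_1)
qed

end

section \<open>The proper quadratic extension: coordinates, bases and traces\<close>

locale proper_quadratic_extension = quadratic_extension +
  fixes L :: "'a set"
  assumes \<delta>_notin_K: "\<delta> \<notin> K" and L_def: "L = generate_field ambient (insert \<delta> K)"
begin

lemma coordinates_eq_iff:
  assumes "a \<in> K" "b \<in> K" "a' \<in> K" "b' \<in> K"
  shows "a + b * \<delta> = a' + b' * \<delta> \<longleftrightarrow> a = a' \<and> b = b'"
proof
  assume eq: "a + b * \<delta> = a' + b' * \<delta>"
  have "b = b'"
  proof (rule ccontr)
    assume "b \<noteq> b'"
    hence "\<delta> = (a' - a) / (b - b')" using eq by (simp add: field_simps)
    thus False using \<delta>_notin_K assms by (metis K_diff K_divide)
  qed
  thus "a = a' \<and> b = b'" using eq by simp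
qed auto

lemma norm_nonzero:
  assumes "a \<in> K" "b \<in> K" "a \<noteq> 0 \<or> b \<noteq> 0"
  shows "a ^ 2 - b ^ 2 * \<Delta> \<noteq> 0"
proof
  assume "a ^ 2 - b ^ 2 * \<Delta> = 0"
  hence "(a + b * \<delta>) * (a + (- b) * \<delta>) = 0"
    by (simp add: algebra_simps power2_eq_square \<delta>_mult_\<delta>)
  hence "a + b * \<delta> = 0 + 0 * \<delta> \<or> a + (- b) * \<delta> = 0 + 0 * \<delta>" by simp
  thus False using assms coordinates_eq_iff[of a b 0 0] coordinates_eq_iff[of a "- b" 0 0] by auto
qed

text \<open>Inverses come from the conjugate divided by the norm, which is nonzero because
  \<open>\<delta> \<notin> K\<close>.\<close>

lemma L_eq: "L = {a + b * \<delta> | a b. a \<in> K \<and> b \<in> K}"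
  unfolding L_def
proof (rule field.generate_fieldI[OF field_ambient, symmetric])
  let ?E = "{a + b * \<delta> | a b. a \<in> K \<and> b \<in> K}"
  have E: "a + b * \<delta> \<in> ?E" if "a \<in> K" "b \<in> K" for a b using that by blast
  show "subfield ?E ambient"
  proof (rule subfield_ambientI)
    show "1 \<in> ?E" using E[of 1 0] by simp
    show "- x \<in> ?E" if x: "x \<in> ?E" for x
    proof -
      obtain a b where "x = a + b * \<delta>" "a \<in> K" "b \<in> K" using x by blast
      thus ?thesis using E[of "- a" "- b"] by simp
    qed
    show "x + y \<in> ?E" if xy: "x \<in> ?E" "y \<in> ?E" for x y
    proof -
      obtain a b a' b' where "x = a + b * \<delta>" "a \<in> K" "b \<in> K" "y = a' + b' * \<delta>" "a' \<in> K" "b' \<in> K"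
        using xy by blast
      thus ?thesis using E[of "a + a'" "b + b'"] by (simp add: algebra_simps)
    qed
    show "x * y \<in> ?E" if xy: "x \<in> ?E" "y \<in> ?E" for x y
    proof -
      obtain a b a' b' where "x = a + b * \<delta>" "a \<in> K" "b \<in> K" "y = a' + b' * \<delta>" "a' \<in> K" "b' \<in> K"
        using xy by blast
      thus ?thesis using E[of "a * a' + b * b' * \<Delta>" "a * b' + b * a'"]
        by (simp add: algebra_simps \<delta>_mult_\<delta>)
    qed
    show "inverse x \<in> ?E" if x: "x \<in> ?E" for x
    proof (cases "x = 0")
      case True
      thus ?thesis using E[of 0 0] by simp
    next
      case False
      obtain a b where ab: "x = a + b * \<delta>" "a \<in> K" "b \<in> K" using x by blast
      define N where "N = a ^ 2 - b ^ 2 * \<Delta>"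
      have "a \<noteq> 0 \<or> b \<noteq> 0" using ab(1) False by auto
      hence N: "N \<noteq> 0" "N \<in> K" using norm_nonzero[OF ab(2,3)] ab(2,3) by (simp_all add: N_def)
      have "x * (a / N + (- b / N) * \<delta>) = (x * (a - b * \<delta>)) / N"
        by (simp add: algebra_simps diff_divide_distrib)
      also have "x * (a - b * \<delta>) = N"
        by (simp add: ab N_def algebra_simps power2_eq_square \<delta>_mult_\<delta>)
      finally have "inverse x = a / N + (- b / N) * \<delta>" using N by (intro inverse_unique) simp
      thus ?thesis using E[of "a / N" "- b / N"] ab N by simp
    qed
  qed
  show "insert \<delta> K \<subseteq> ?E" using E[of 0 1] E[of _ 0] by auto
  fix F assume F: "subfield F ambient" "insert \<delta> K \<subseteq> F"
  show "?E \<subseteq> F"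
    using F(2) by (auto intro!: subringE(6,7)[OF subfieldE(1)[OF F(1)], simplified])
qed simp

lemma field_basis_if_coefficient_nonzero:
  assumes "a \<in> K" "b \<in> K" "b \<noteq> 0"
  shows "field_basis K L [1, a + b * \<delta>]"
proof -
  have "a + b * \<delta> \<noteq> 0" using coordinates_eq_iff[of a b 0 0] assms by simp
  moreover have "1 \<noteq> k * (a + b * \<delta>)" if "k \<in> K" for k
  proof
    assume eq: "1 = k * (a + b * \<delta>)"
    hence "1 + 0 * \<delta> = k * a + k * b * \<delta>" by (simp add: algebra_simps)
    hence "k * b = 0" using coordinates_eq_iff[of 1 0 "k * a" "k * b"] assms that by simp
    thus False using eq assms by simp
  qed
  ultimately have "ambient.independent K [1, a + b * \<delta>]"
    by (intro ambient.independent.intros) (auto simp: ambient.line_extension_mem_iff)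
  moreover have "ambient.Span K [1, a + b * \<delta>] = L"
    unfolding Span_pair L_eq
  proof (intro equalityI subsetI)
    fix x assume "x \<in> {k * 1 + l * (a + b * \<delta>) | k l. k \<in> K \<and> l \<in> K}"
    then obtain k l where "k \<in> K" "l \<in> K" "x = k * 1 + l * (a + b * \<delta>)" by blast
    hence "x = (k + l * a) + (l * b) * \<delta>" "k + l * a \<in> K" "l * b \<in> K"
      using assms by (auto simp: algebra_simps)
    thus "x \<in> {a + b * \<delta> | a b. a \<in> K \<and> b \<in> K}" by blast
  next
    fix x assume "x \<in> {a + b * \<delta> | a b. a \<in> K \<and> b \<in> K}"
    then obtain k l where "k \<in> K" "l \<in> K" "x = k + l * \<delta>" by blast
    hence "x = (k - l / b * a) * 1 + (l / b) * (a + b * \<delta>)" "k - l / b * a \<in> K" "l / b \<in> K"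
      using assms by (auto simp: algebra_simps)
    thus "x \<in> {k * 1 + l * (a + b * \<delta>) | k l. k \<in> K \<and> l \<in> K}" by blast
  qed
  ultimately show ?thesis by (simp only: field_basis_def)
qed

lemma field_basisE:
  assumes "field_basis K L bs"
  obtains a b a' b' where "bs = [a + b * \<delta>, a' + b' * \<delta>]" "a \<in> K" "b \<in> K" "a' \<in> K" "b' \<in> K"
    "a * b' - a' * b \<noteq> 0"
proof -
  have ind: "ambient.independent K bs" "ambient.Span K bs = L"
    using assms by (auto simp only: field_basis_def)
  have "ambient.dimension (length bs) K L" using ambient.dimensionI[OF subfield_K ind] .
  moreover have "field_basis K L [1, 0 + 1 * \<delta>]" by (rule field_basis_if_coefficient_nonzero) auto
  hence "ambient.dimension (length [1, 0 + 1 * \<delta>]) K L"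
    unfolding field_basis_def by (blast intro: ambient.dimensionI[OF subfield_K])
  ultimately have "length bs = 2"
    using ambient.dimension_is_inj[OF subfield_K] by fastforce
  then obtain x y where xy: "bs = [x, y]" by (auto simp: numeral_2_eq_2 length_Suc_conv)
  have "1 * x + 0 * y \<in> ambient.Span K [x, y]" "0 * x + 1 * y \<in> ambient.Span K [x, y]"
    unfolding Span_pair using K_closed(1,2) by blast+
  hence "x \<in> L" "y \<in> L" using ind(2) xy by simp_all
  then obtain a b a' b' where ab: "x = a + b * \<delta>" "y = a' + b' * \<delta>" "a \<in> K" "b \<in> K" "a' \<in> K" "b' \<in> K"
    unfolding L_eq by blast
  \<comment> \<open>If it vanished, the coefficients \<open>b', - b\<close> and
    \<open>a', - a\<close> would give relations between \<open>x\<close> and \<open>y\<close>,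
    forcing all four coordinates to be 0.\<close>
  have "a * b' - a' * b \<noteq> 0"
  proof
    assume det0: "a * b' - a' * b = 0"
    have triv: "k = 0 \<and> l = 0" if "k \<in> K" "l \<in> K" "k * x + l * y = 0" for k l
      using ambient.independent_imp_trivial_combine[OF subfield_K ind(1), of "[k, l]"] that xy by simp
    have "b' * x + (- b) * y = a * b' - a' * b" by (simp add: ab algebra_simps)
    hence "b' = 0" "b = 0" using triv[of b' "- b"] ab det0 by auto
    moreover have "a' * x + (- a) * y = (a' * b - a * b') * \<delta>" by (simp add: ab algebra_simps)
    hence "a' = 0" "a = 0" using triv[of a' "- a"] ab det0 by auto
    ultimately have "x = y" using ab by simp
    thus False using ambient.independent_distinct[OF subfield_K ind(1)] xy by simp
  qed
  thus ?thesis using that ab xy by blast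
qed

text \<open>The definite description demands the same value from every basis; invariance of the
  trace is computed in coordinates.\<close>

lemma rel_trace_eq:
  assumes uv: "u \<in> K" "v \<in> K"
  shows "rel_trace K L (u + v * \<delta>) = 2 * u"
  unfolding rel_trace_def
proof (rule the_equality)
  \<comment> \<open>The columns are the images of \<open>1\<close> and \<open>\<delta>\<close>,
    namely \<open>u + v * \<delta>\<close> and \<open>v * \<Delta> + u * \<delta>\<close>.\<close>
  define A where "A = mat 2 2 (\<lambda>(i, j). if i = j then u else if i = 0 then v * \<Delta> else v)"
  have "field_basis K L [1, \<delta>]" using field_basis_if_coefficient_nonzero[of 0 1] by simp
  moreover have "mult_matrix K [1, \<delta>] (u + v * \<delta>) A"
    using uv by (auto simp: mult_matrix_def A_def elements_mat_def numeral_2_eq_2 less_Suc_eq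
        algebra_simps \<delta>_mult_\<delta>)
  moreover have "2 * u = (\<Sum>i<length [1, \<delta>]. A $$ (i, i))" by (simp add: A_def numeral_2_eq_2)
  ultimately show "\<exists>b A. field_basis K L b \<and> mult_matrix K b (u + v * \<delta>) A \<and>
      2 * u = (\<Sum>i<length b. A $$ (i, i))" by blast
  fix t
  assume "\<exists>b A. field_basis K L b \<and> mult_matrix K b (u + v * \<delta>) A \<and> t = (\<Sum>i<length b. A $$ (i, i))"
  then obtain bs A where bs: "field_basis K L bs" and A: "mult_matrix K bs (u + v * \<delta>) A"
    and t: "t = (\<Sum>i<length bs. A $$ (i, i))" by blast
  obtain a b a' b' where ab: "bs = [a + b * \<delta>, a' + b' * \<delta>]" "a \<in> K" "b \<in> K" "a' \<in> K" "b' \<in> K"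
    and det: "a * b' - a' * b \<noteq> 0" using field_basisE[OF bs] .
  define p q r s where "p = A $$ (0, 0)" and "q = A $$ (1, 0)" and "r = A $$ (0, 1)" and "s = A $$ (1, 1)"
  have A2: "A \<in> carrier_mat 2 2" "elements_mat A \<subseteq> K"
    using A ab(1) by (auto simp: mult_matrix_def numeral_2_eq_2)
  have "A $$ (i, j) \<in> K" if "i < 2" "j < 2" for i j
    using A2 elements_matI[OF A2(1) that refl] by blast
  hence K: "p \<in> K" "q \<in> K" "r \<in> K" "s \<in> K" by (simp_all add: p_def q_def r_def s_def)
  have eq: "(u + v * \<delta>) * bs ! j = (\<Sum>i<2. A $$ (i, j) * bs ! i)" if "j < 2" for j
    using A ab(1) that by (simp add: mult_matrix_def numeral_2_eq_2)
  have "(u * a + v * b * \<Delta>) + (u * b + v * a) * \<delta> = (p * a + q * a') + (p * b + q * b') * \<delta>"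
    using eq[of 0] ab(1) by (simp add: p_def q_def numeral_2_eq_2 algebra_simps \<delta>_mult_\<delta>)
  hence 1: "u * a + v * b * \<Delta> = p * a + q * a'" "u * b + v * a = p * b + q * b'"
    using coordinates_eq_iff ab K uv by (simp_all)
  have "(u * a' + v * b' * \<Delta>) + (u * b' + v * a') * \<delta> = (r * a + s * a') + (r * b + s * b') * \<delta>"
    using eq[of 1] ab(1) by (simp add: r_def s_def numeral_2_eq_2 algebra_simps \<delta>_mult_\<delta>)
  hence 2: "u * a' + v * b' * \<Delta> = r * a + s * a'" "u * b' + v * a' = r * b + s * b'"
    using coordinates_eq_iff ab K uv by (simp_all)
  \<comment> \<open>As in Cramer's rule, \<open>q\<close> and \<open>r\<close> cancel and the trace
    remains, multiplied by the determinant of the basis.\<close>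
  have "(p + s) * (a * b' - a' * b) =
      (p * a + q * a') * b' - (p * b + q * b') * a' + ((r * b + s * b') * a - (r * a + s * a') * b)"
    by (simp add: algebra_simps)
  also have "\<dots> = 2 * u * (a * b' - a' * b)"
    unfolding 1[symmetric] 2[symmetric] by (simp add: algebra_simps)
  finally have "(p + s) * (a * b' - a' * b) = 2 * u * (a * b' - a' * b)" .
  hence "p + s = 2 * u" using det by simp
  moreover have "t = p + s" using t ab(1) by (simp add: p_def s_def numeral_2_eq_2)
  ultimately show "t = 2 * u" by simp
qed

text \<open>On \<open>1, \<delta>\<close> the trace form is diagonal with entries 2 and
  \<open>2 * \<Delta>\<close>; a change of basis multiplies its determinant by the square of the
  coordinate determinant.\<close>

lemma basis_discriminant_eq:
  assumes "a \<in> K" "b \<in> K" "a' \<in> K" "b' \<in> K"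
  shows "basis_discriminant K L [a + b * \<delta>, a' + b' * \<delta>] = (4 * \<Delta>) * (a * b' - a' * b) ^ 2"
proof -
  have tr: "rel_trace K L ((a + b * \<delta>) * (a' + b' * \<delta>)) = 2 * (a * a' + b * b' * \<Delta>)"
    if "a \<in> K" "b \<in> K" "a' \<in> K" "b' \<in> K" for a b a' b'
  proof -
    have "(a + b * \<delta>) * (a' + b' * \<delta>) = (a * a' + b * b' * \<Delta>) + (a * b' + b * a') * \<delta>"
      by (simp add: algebra_simps \<delta>_mult_\<delta>)
    thus ?thesis using rel_trace_eq that by simp
  qed
  have len: "length [a + b * \<delta>, a' + b' * \<delta>] = 2" by simp
  show ?thesis
    unfolding basis_discriminant_def len det_2_mat
    using assms by (simp add: tr) (simp add: power2_eq_square algebra_simps)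
qed

text \<open>An integer polynomial takes conjugate values \<open>u + v * \<delta>\<close> and
  \<open>u - v * \<delta>\<close> at conjugate arguments. If one value is 0, then
  \<open>u = v = 0\<close> and so is the other.\<close>

lemma algebraic_int_conjugate:
  assumes "a \<in> K" "b \<in> K" "algebraic_int (a + b * \<delta>)"
  shows "algebraic_int (a - b * \<delta>)"
proof -
  obtain p :: "int poly" where p: "poly (map_poly of_int p) (a + b * \<delta>) = 0" "lead_coeff p = 1"
    using assms(3) by (auto simp: algebraic_int_altdef_ipoly)
  have "\<exists>u\<in>K. \<exists>v\<in>K. poly (map_poly of_int p) (a + b * \<delta>) = u + v * \<delta> \<and>
    poly (map_poly of_int p) (a - b * \<delta>) = u - v * \<delta>" for p
  proof (induction p)
    case 0
    show ?case by (rule bexI[of _ 0], rule bexI[of _ 0]) auto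
  next
    case (pCons c p)
    then obtain u v where uv: "u \<in> K" "v \<in> K" "poly (map_poly of_int p) (a + b * \<delta>) = u + v * \<delta>"
      "poly (map_poly of_int p) (a - b * \<delta>) = u - v * \<delta>" by blast
    have "poly (map_poly of_int (pCons c p)) (a + b * \<delta>) =
        (of_int c + a * u + b * v * \<Delta>) + (a * v + b * u) * \<delta>"
      "poly (map_poly of_int (pCons c p)) (a - b * \<delta>) =
        (of_int c + a * u + b * v * \<Delta>) - (a * v + b * u) * \<delta>"
      by (simp_all only: of_int_hom.map_poly_pCons_hom poly_pCons uv) (simp_all add: algebra_simps \<delta>_mult_\<delta>)
    moreover have "of_int c + a * u + b * v * \<Delta> \<in> K" "a * v + b * u \<in> K" using uv assms by auto
    ultimately show ?case by blast
  qed
  then obtain u v where uv: "u \<in> K" "v \<in> K" "poly (map_poly of_int p) (a + b * \<delta>) = u + v * \<delta>"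
    "poly (map_poly of_int p) (a - b * \<delta>) = u - v * \<delta>" by blast
  have "u + v * \<delta> = 0 + 0 * \<delta>" using uv p by simp
  hence "poly (map_poly of_int p) (a - b * \<delta>) = 0"
    using uv coordinates_eq_iff[of u v 0 0] by simp
  thus ?thesis using p(2) by (auto simp: algebraic_int_altdef_ipoly)
qed

lemma ring_of_integers_L_iff:
  assumes "a \<in> K" "b \<in> K"
  shows "a + b * \<delta> \<in> carrier (ring_of_integers L) \<longleftrightarrow> integral_pair a b"
proof -
  have "a + b * \<delta> \<in> L" using assms L_eq by blast
  thus ?thesis
    using assms algebraic_int_conjugate[OF assms] by (auto simp: ring_of_integers_def integral_pair_def)
qed

text \<open>Every discriminant is \<open>4 * \<Delta>\<close> times the square of an element of
  \<open>\<BB>\<close>. Conversely the bases \<open>[1, a + b * \<delta>]\<close> realize all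
  nonzero \<open>b \<in> \<BB>\<close>, and these squares generate
  \<open>\<BB> \<odot> \<BB>\<close>.\<close>

lemma relative_discriminant_proper: "relative_discriminant K L = principal (4 * \<Delta>) \<odot> (\<BB> \<odot> \<BB>)"
proof
  let ?D = "{basis_discriminant K L b | b. field_basis K L b \<and> set b \<subseteq> carrier (ring_of_integers L)}"
  let ?R = "principal (4 * \<Delta>) \<odot> (\<BB> \<odot> \<BB>)"
  have R: "O_module ?R" by (intro O_module_prod O_module_principal O_module_\<BB>) simp_all
  have "\<BB> \<odot> \<BB> \<subseteq> inverse_ideal K (principal (4 * \<Delta>))"
    using inverse_ideal_antimono[of "principal (4 * \<Delta>)" "\<FF> \<odot> \<FF>"] \<Delta>_in_\<GG>_square
    using mem_principal_prod_iff[OF O_module_prod, of \<GG> \<GG> 4 "4 * \<Delta>"] invertible_\<GG>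
    by (simp add: \<GG>_square invertible_imp_O_module principal_subset_iff O_module_prod
        invertible_prod invertible_SFT inverse_SFT)
  hence "?R \<subseteq> principal (4 * \<Delta>) \<odot> inverse_ideal K (principal (4 * \<Delta>))"
    by (intro module_prod_mono) auto
  also have "\<dots> = \<O>"
    using \<Delta>_nonzero by (intro prod_inverse_ideal invertible_principal) simp_all
  finally have R_ideal: "ideal ?R (ring_of_integers K)" using R by (simp add: ideal_iff)
  have "?D \<subseteq> ?R"
  proof
    fix d assume "d \<in> ?D"
    then obtain bs where bs: "d = basis_discriminant K L bs" "field_basis K L bs"
      "set bs \<subseteq> carrier (ring_of_integers L)" by blast
    obtain a b a' b' where ab: "bs = [a + b * \<delta>, a' + b' * \<delta>]" "a \<in> K" "b \<in> K" "a' \<in> K" "b' \<in> K"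
      using field_basisE[OF bs(2)] by metis
    have "integral_pair a b" "integral_pair a' b'"
      using bs(3) ab ring_of_integers_L_iff by auto
    \<comment> \<open>The coordinate determinant is the coefficient of \<open>\<delta>\<close> in
      the conjugate of the first basis element times the second.\<close>
    hence "algebraic_int ((a - b * \<delta>) * (a' + b' * \<delta>))" "algebraic_int ((a + b * \<delta>) * (a' - b' * \<delta>))"
      by (auto simp: integral_pair_def)
    moreover have "(a - b * \<delta>) * (a' + b' * \<delta>) = (a * a' - b * b' * \<Delta>) + (a * b' - a' * b) * \<delta>"
      "(a + b * \<delta>) * (a' - b' * \<delta>) = (a * a' - b * b' * \<Delta>) - (a * b' - a' * b) * \<delta>"
      by (simp_all add: algebra_simps \<delta>_mult_\<delta>)
    ultimately have "integral_pair (a * a' - b * b' * \<Delta>) (a * b' - a' * b)"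
      using ab by (simp add: integral_pair_def)
    hence "a * b' - a' * b \<in> \<BB>" by (auto simp: \<BB>_def)
    hence "(4 * \<Delta>) * (a * b' - a' * b) ^ 2 \<in> ?R"
      unfolding power2_eq_square by (intro module_prodI self_mem_principal)
    thus "d \<in> ?R" using bs(1) ab basis_discriminant_eq by simp
  qed
  thus "relative_discriminant K L \<subseteq> ?R"
    unfolding relative_discriminant_def
    by (rule ring.genideal_minimal[OF ring_ring_of_integers R_ideal])
  have "?R \<subseteq> I" if I: "ideal I (ring_of_integers K)" "?D \<subseteq> I" for I
  proof -
    have mod: "O_module I" using I by (simp add: ideal_iff)
    have "(4 * \<Delta>) * b ^ 2 \<in> I" if b: "b \<in> \<BB>" for b
    \<comment> \<open>For \<open>b = 0\<close> the list \<open>[1, a + b * \<delta>]\<close> is not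
      a basis.\<close>
    proof (cases "b = 0")
      case True
      thus ?thesis using O_moduleD(3)[OF mod] by simp
    next
      case False
      obtain a where a: "integral_pair a b" using b by (auto simp: \<BB>_def)
      hence K: "a \<in> K" "b \<in> K" by (auto simp: integral_pair_def)
      have "1 \<in> carrier (ring_of_integers L)"
        using ring_of_integers_L_iff[of 1 0] by (simp add: integral_pair_iff)
      hence "set [1, a + b * \<delta>] \<subseteq> carrier (ring_of_integers L)"
        using ring_of_integers_L_iff[OF K] a by simp
      hence "basis_discriminant K L [1, a + b * \<delta>] \<in> ?D"
        using field_basis_if_coefficient_nonzero[OF K False] by blast
      moreover have "basis_discriminant K L [1, a + b * \<delta>] = (4 * \<Delta>) * b ^ 2"
        using basis_discriminant_eq[of 1 0 a b] K by simp
      ultimately show ?thesis using I by auto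
    qed
    moreover define N where "N = {y \<in> K. (4 * \<Delta>) * y \<in> I}"
    ultimately have "b ^ 2 \<in> N" if "b \<in> \<BB>" for b
      using that O_moduleD(2)[OF O_module_\<BB>] by (simp add: N_def)
    moreover have "O_module N"
    proof (rule O_moduleI)
      show "r * x \<in> N" if "r \<in> \<O>" "x \<in> N" for r x
        using O_moduleD(5)[OF mod, of r "4 * \<Delta> * x"] that by (auto simp: N_def mult_ac)
    qed (use O_moduleD(3,4)[OF mod] in \<open>auto simp: N_def distrib_left\<close>)
    ultimately have "\<BB> \<odot> \<BB> \<subseteq> N" using squares_imp_module_prod_subset[OF O_module_\<BB>] by blast
    thus "?R \<subseteq> I"
    proof (intro module_prod_subset_module mod)
      fix x y assume "\<BB> \<odot> \<BB> \<subseteq> N" "x \<in> principal (4 * \<Delta>)" "y \<in> \<BB> \<odot> \<BB>"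
      then obtain r where "r \<in> \<O>" "x = r * (4 * \<Delta>)" "(4 * \<Delta>) * y \<in> I"
        by (auto simp: principal_def N_def)
      thus "x * y \<in> I" using O_moduleD(5)[OF mod, of r "4 * \<Delta> * y"] by (simp add: mult_ac)
    qed
  qed
  thus "?R \<subseteq> relative_discriminant K L"
    unfolding relative_discriminant_def genideal_def by blast
qed

end

lemma (in quadratic_extension) relative_discriminant_eq:
  "relative_discriminant K (generate_field ambient (insert \<delta> K)) = principal (4 * \<Delta>) \<odot> (\<BB> \<odot> \<BB>)"
proof (cases "\<delta> \<in> K")
  case True
  thus ?thesis
    by (simp add: generate_field_of_mem relative_discriminant_self discriminant_trivial_extension)
next
  case False
  then interpret proper_quadratic_extension K \<Delta> \<delta> "generate_field ambient (insert \<delta> K)"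
    by unfold_locales simp_all
  show ?thesis by (rule relative_discriminant_proper)
qed

theorem theorem2:
  fixes K L :: "'a :: field_char_0 set" and \<Delta> sqrt\<Delta> :: 'a
  assumes "number_field K"
    and "\<Delta> \<in> carrier (ring_of_integers K)" and "\<Delta> \<noteq> 0"
    and "sqrt\<Delta> ^ 2 = \<Delta>" and "L = generate_field ambient (insert sqrt\<Delta> K)"
  shows "(let s = largest_ideal K (\<lambda>\<aa>.
                \<aa> [^]\<^bsub>integral_ideals K\<^esub> (2::nat) divides\<^bsub>integral_ideals K\<^esub> principal_ideal K \<Delta>);
              t = largest_ideal K (\<lambda>\<bb>.
                \<bb> divides\<^bsub>integral_ideals K\<^esub> principal_ideal K 2 \<and>
                square_modulo K \<Delta> ((s \<otimes>\<^bsub>integral_ideals K\<^esub> \<bb>) [^]\<^bsub>integral_ideals K\<^esub> (2::nat)))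
          in relative_discriminant K L =
               ideal_quotient K (principal_ideal K (4 * \<Delta>))
                 ((s \<otimes>\<^bsub>integral_ideals K\<^esub> t) [^]\<^bsub>integral_ideals K\<^esub> (2::nat)))
       \<and> (is_discriminant K \<Delta> \<longrightarrow>
            relative_discriminant K L =
              ideal_quotient K (principal_ideal K \<Delta>)
                (conductor_ideal K \<Delta> [^]\<^bsub>integral_ideals K\<^esub> (2::nat)))"
proof -
  interpret number_field_carrier K by unfold_locales fact
  interpret quadratic_extension K \<Delta> "sqrt\<Delta>"
    using assms carrier_ring_of_integers by unfold_locales auto
  \<comment> \<open>Once the divisors are known to be \<open>\<FF> \<odot> \<FF>\<close> and
    \<open>\<GG> \<odot> \<GG>\<close>, both quotients equal
    \<open>principal (4 * \<Delta>) \<odot> (\<BB> \<odot> \<BB>)\<close>.\<close>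
  have "(\<SS> \<otimes>\<^bsub>integral_ideals K\<^esub> \<TT>) [^]\<^bsub>integral_ideals K\<^esub> (2::nat) = \<FF> \<odot> \<FF>"
    by (simp add: integral_ideals_mult \<SS>_mult_\<TT> integral_ideals_square)
  moreover have "conductor_ideal K \<Delta> [^]\<^bsub>integral_ideals K\<^esub> (2::nat) = \<GG> \<odot> \<GG>"
    if "is_discriminant K \<Delta>"
    using conductor_ideal_eq[OF that] invertible_\<GG>
    by (simp add: integral_ideals_square invertible_imp_O_module)
  ultimately show ?thesis
    unfolding Let_def largest_square_divisor largest_square_modulus assms(5)
    by (simp add: relative_discriminant_eq ideal_quotient_\<FF> ideal_quotient_\<GG>)
qed

end
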